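(* Let $G=(V,E,L)$ be a looped simple graph and let $r^{lc}_2$ denote the rank function of the generic 2-dimensional linearly constrained rigidity matroid of $G$. Then $$r^{lc}_2(G)=\min\{\mathrm{val}(\mathcal{X}) : L'\subseteq L,\ \mathcal{X} \text{ is an admissible 1-thin cover of } G-L'\}.$$
   Context: A looped simple graph $G=(V,E,L)$ consists of a finite vertex set $V$, a set $E$ of edges forming a simple graph on $V$ (no multiple edges), and a set $L$ of loops, each incident with one vertex (multiple loops at a vertex are allowed). A 2-dimensional linearly constrained framework is a triple $(G,p,q)$ with $p:V\to\mathbb{R}^2$, $q:L\to\mathbb{R}^2$. Its rigidity matrix $R(G,p,q)$ is the $(|E|+|L|)\times 2|V|$ matrix with two columns per vertex, where the row of an edge $uv$ has $p(u)-p(v)$ in the columns of $u$, $p(v)-p(u)$ in the columns of $v$, and zeros elsewhere, and the row of a loop $l$ at $v$ has $q(l)$ in the columns of $v$ and zeros elsewhere. $(p,q)$ is generic if all its coordinates are algebraically independent over $\mathbb{Q}$. The generic linearly constrained rigidity matroid of $G$ is the matroid on $E\cup L$ in which a set is independent iff the corresponding rows of $R(G,p,q)$ are linearly independent for generic $(p,q)$ (this does not depend on the generic choice); $r^{lc}_2$ is its rank function and $r^{lc}_2(G)=r^{lc}_2(E\cup L)$. For $L'\subseteq L$, $G-L'=(V,E,L\setminus L')$. A family $\mathcal{X}=\{X_0,X_1,\dots,X_k\}$ of subsets of $V$ with $|X_i|\ge 2$ for $1\le i\le k$ ($X_0$ may be empty, $k\ge 0$) is a cover of a looped simple graph if every edge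 and every loop of it is induced by (i.e. has all its endpoints in) at least one member of $\mathcal{X}$. A cover $\mathcal{X}$ of $G-L'$ is admissible if every loop in $L\setminus L'$ is at a vertex of $X_0$ and every loop in $L'$ is at a vertex of $V\setminus X_0$. It is 1-thin if $|X_i\cap X_j|\le 1$ for all $0\le i<j\le k$. Its value is $\mathrm{val}(\mathcal{X})=|L'|+2|X_0|+\sum_{i=1}^k(2|X_i|-3)$. *)

theory Defs
  imports "HOL-Analysis.Analysis" "HOL-Library.Poly_Mapping"
begin

(* Loops are abstract objects, so several loops may share the same base vertex. *)
record ('v, 'l) looped_graph =
  verts :: "'v set"
  edges :: "'v set set"
  loops :: "'l set"
  base :: "'l \<Rightarrow> 'v"

definition looped_simple_graph :: "('v, 'l) looped_graph \<Rightarrow> bool" where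
  "looped_simple_graph G \<longleftrightarrow>
     finite (verts G) \<and>
     (\<forall>e\<in>edges G. e \<subseteq> verts G \<and> card e = 2) \<and>
     finite (loops G) \<and>
     (\<forall>l\<in>loops G. base G l \<in> verts G)"

definition delete_loops :: "('v, 'l) looped_graph \<Rightarrow> 'l set \<Rightarrow> ('v, 'l) looped_graph" where
  "delete_loops G L' = G\<lparr>loops := loops G - L'\<rparr>"

(* The disjoint union of the edge set and the loop set; it indexes the rows of the
   rigidity matrix. *)
definition ground :: "('v, 'l) looped_graph \<Rightarrow> ('v set + 'l) set" where
  "ground G = edges G <+> loops G"

(* In the row of an edge e = {v, w}, the two columns of v hold p v - p w; here w is the
   unique element of e - {v}. *)
fun rigidity_matrix ::
  "('v, 'l) looped_graph \<Rightarrow> ('v \<Rightarrow> real^2) \<Rightarrow> ('l \<Rightarrow> real^2) \<Rightarrow> 'v set + 'l \<Rightarrow> 'v \<times> 2 \<Rightarrow> real"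
where
  "rigidity_matrix G p q (Inl e) (v, i) =
     (if v \<in> e then (p v - p (the_elem (e - {v}))) $ i else 0)"
| "rigidity_matrix G p q (Inr l) (v, i) = (if v = base G l then q l $ i else 0)"

(* Linear independence of the rows as an indexed family: equal rows with different indices
   are dependent. *)
definition rows_independent ::
  "('r \<Rightarrow> 'c \<Rightarrow> real) \<Rightarrow> 'r set \<Rightarrow> 'c set \<Rightarrow> bool"
where
  "rows_independent M R C \<longleftrightarrow>
     (\<forall>a. (\<forall>j\<in>C. (\<Sum>r\<in>R. a r * M r j) = 0) \<longrightarrow> (\<forall>r\<in>R. a r = 0))"

(* A polynomial over the rationals is a finitely supported map from monomials to
   coefficients; a monomial is a finitely supported map from variables to exponents. *)
definition eval_poly :: "('i \<Rightarrow> real) \<Rightarrow> (('i \<Rightarrow>\<^sub>0 nat) \<Rightarrow>\<^sub>0 rat) \<Rightarrow> real" where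
  "eval_poly x P =
     (\<Sum>m\<in>Poly_Mapping.keys P. of_rat (Poly_Mapping.lookup P m) *
        (\<Prod>i\<in>Poly_Mapping.keys m. x i ^ Poly_Mapping.lookup m i))"

definition algebraically_independent :: "('i \<Rightarrow> real) \<Rightarrow> 'i set \<Rightarrow> bool" where
  "algebraically_independent x I \<longleftrightarrow>
     (\<forall>P. (\<forall>m\<in>Poly_Mapping.keys P. Poly_Mapping.keys m \<subseteq> I) \<and> eval_poly x P = 0 \<longrightarrow> P = 0)"

fun coords :: "('v \<Rightarrow> real^2) \<Rightarrow> ('l \<Rightarrow> real^2) \<Rightarrow> ('v \<times> 2) + ('l \<times> 2) \<Rightarrow> real" where
  "coords p q (Inl (v, i)) = p v $ i"
| "coords p q (Inr (l, i)) = q l $ i"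

definition generic ::
  "('v, 'l) looped_graph \<Rightarrow> ('v \<Rightarrow> real^2) \<Rightarrow> ('l \<Rightarrow> real^2) \<Rightarrow> bool"
where
  "generic G p q \<longleftrightarrow>
     algebraically_independent (coords p q) ((verts G \<times> UNIV) <+> (loops G \<times> UNIV))"

(* Whether the rows are independent does not depend on the generic pair (p, q), and generic
   pairs exist, so "for some" is the same as "for every" generic pair. *)
definition lc_independent :: "('v, 'l) looped_graph \<Rightarrow> ('v set + 'l) set \<Rightarrow> bool" where
  "lc_independent G F \<longleftrightarrow>
     F \<subseteq> ground G \<and>
     (\<exists>p q. generic G p q \<and> rows_independent (rigidity_matrix G p q) F (verts G \<times> UNIV))"

definition lc_rank :: "('v, 'l) looped_graph \<Rightarrow> ('v set + 'l) set \<Rightarrow> nat" where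
  "lc_rank G F = Max {card I | I. I \<subseteq> F \<and> lc_independent G I}"

(* A family X 0, ..., X k is a function on the naturals together with the last index k;
   values of X beyond k are irrelevant. *)
definition is_cover :: "('v, 'l) looped_graph \<Rightarrow> nat \<Rightarrow> (nat \<Rightarrow> 'v set) \<Rightarrow> bool" where
  "is_cover G k X \<longleftrightarrow>
     (\<forall>i\<le>k. X i \<subseteq> verts G) \<and>
     (\<forall>i\<in>{1..k}. card (X i) \<ge> 2) \<and>
     (\<forall>e\<in>edges G. \<exists>i\<le>k. e \<subseteq> X i) \<and>
     (\<forall>l\<in>loops G. \<exists>i\<le>k. base G l \<in> X i)"

definition admissible :: "('v, 'l) looped_graph \<Rightarrow> 'l set \<Rightarrow> (nat \<Rightarrow> 'v set) \<Rightarrow> bool" where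
  "admissible G L' X \<longleftrightarrow>
     (\<forall>l\<in>loops G - L'. base G l \<in> X 0) \<and>
     (\<forall>l\<in>L'. base G l \<in> verts G - X 0)"

definition one_thin :: "nat \<Rightarrow> (nat \<Rightarrow> 'v set) \<Rightarrow> bool" where
  "one_thin k X \<longleftrightarrow> (\<forall>i j. i < j \<and> j \<le> k \<longrightarrow> card (X i \<inter> X j) \<le> 1)"

definition cover_val :: "'l set \<Rightarrow> nat \<Rightarrow> (nat \<Rightarrow> 'v set) \<Rightarrow> int" where
  "cover_val L' k X =
     int (card L') + 2 * int (card (X 0)) + (\<Sum>i=1..k. 2 * int (card (X i)) - 3)"

abbreviation (input) admissible_cover_vals :: "('v, 'l) looped_graph \<Rightarrow> int set" where
  "admissible_cover_vals G \<equiv>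
     {cover_val L' k X | L' k X.
        L' \<subseteq> loops G \<and> is_cover (delete_loops G L') k X \<and> admissible G L' X \<and> one_thin k X}"

(* The members of a 1-thin cover with positive index are distinct, so the minimum in the
   rank formula ranges over a finite nonempty set of integers. *)
lemma finite_admissible_cover_vals:
  assumes "looped_simple_graph G"
  shows "finite (admissible_cover_vals G)"
proof -
  have fV: "finite (verts G)" and fL: "finite (loops G)"
    using assms by (auto simp: looped_simple_graph_def)
  let ?n = "int (card (verts G))"
  let ?B = "int (card (loops G)) + 2 * ?n + 2 ^ card (verts G) * (2 * ?n)"
  have "cover_val L' k X \<in> {0..?B}"
    if L': "L' \<subseteq> loops G" and c: "is_cover (delete_loops G L') k X" and t: "one_thin k X"
    for L' k X
  proof -
    have sub: "X i \<subseteq> verts G" if "i \<le> k" for i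
      using c that by (auto simp: is_cover_def delete_loops_def)
    have two: "card (X i) \<ge> 2" if "i \<in> {1..k}" for i
      using c that by (auto simp: is_cover_def delete_loops_def)
    have le: "card (X i) \<le> card (verts G)" if "i \<le> k" for i
      using sub[OF that] fV by (rule card_mono[rotated])
    have inj: "inj_on X {1..k}"
    proof (rule linorder_inj_onI)
      fix i j assume "i < j" "i \<in> {1..k}" "j \<in> {1..k}"
      then have "card (X i \<inter> X j) \<le> 1" "card (X i) \<ge> 2"
        using t two by (auto simp: one_thin_def)
      then show "X i \<noteq> X j" by auto
    qed auto
    have "card (X ` {1..k}) \<le> card (Pow (verts G))"
      using fV sub by (intro card_mono) (simp_all add: image_subset_iff)
    then have k: "k \<le> 2 ^ card (verts G)"
      unfolding card_image[OF inj] using fV by (simp add: card_Pow)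
    have "(\<Sum>i=1..k. 2 * int (card (X i)) - 3) \<le> (\<Sum>i=1..k. 2 * ?n)"
    proof (rule sum_mono)
      fix i assume "i \<in> {1..k}"
      then have "card (X i) \<le> card (verts G)" by (intro le) simp
      then show "2 * int (card (X i)) - 3 \<le> 2 * ?n" by linarith
    qed
    also have "\<dots> = int k * (2 * ?n)" by simp
    also have "\<dots> \<le> 2 ^ card (verts G) * (2 * ?n)"
    proof (rule mult_right_mono)
      show "int k \<le> 2 ^ card (verts G)" using k by (metis of_nat_le_iff of_nat_numeral of_nat_power)
    qed simp
    finally have "(\<Sum>i=1..k. 2 * int (card (X i)) - 3) \<le> 2 ^ card (verts G) * (2 * ?n)" .
    moreover have "(\<Sum>i=1..k. 2 * int (card (X i)) - 3) \<ge> 0"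
    proof (rule sum_nonneg)
      fix i assume "i \<in> {1..k}"
      then show "2 * int (card (X i)) - 3 \<ge> 0" using two[of i] by linarith
    qed
    moreover have "card L' \<le> card (loops G)" using L' fL by (simp add: card_mono)
    moreover have "card (X 0) \<le> card (verts G)" by (rule le) simp
    ultimately show ?thesis by (simp add: cover_val_def)
  qed
  then have "admissible_cover_vals G \<subseteq> {0..?B}"
    by blast
  then show ?thesis by (rule finite_subset) simp
qed

lemma admissible_cover_vals_nonempty:
  fixes G :: "('v, 'l) looped_graph"
  assumes "looped_simple_graph G"
  shows "admissible_cover_vals G \<noteq> {}"
proof -
  have "cover_val ({} :: 'l set) 0 (\<lambda>_. verts G) \<in> admissible_cover_vals G"
    using assms
    by (intro CollectI exI[of _ "{}"] exI[of _ "0::nat"] exI[of _ "\<lambda>_. verts G"])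
       (auto simp: is_cover_def admissible_def one_thin_def delete_loops_def
         looped_simple_graph_def)
  then show ?thesis by blast
qed

end

theory Submission
  imports Defs
begin

text \<open>
  A set of edges and loops is called sparse if every vertex set \<open>X\<close> induces at most \<open>2|X|\<close> of its
  members, and at most \<open>2|X| - 3\<close> edges when \<open>|X| \<ge> 2\<close>. Sparse sets have linearly independent rows
  for some placement: a vertex of low degree is removed (moving a loop to a neighbour, or inserting an
  edge between two neighbours, so that sparsity is kept), the rest is realised by induction, and the
  vertex is put back in a special position in which every stress of the larger framework induces one
  of the smaller. Independence is an open condition and generic placements are dense, so independence
  passes to a generic placement.

  For a maximal sparse set, unions of sets attaining \<open>2|X|\<close> attain it again; let \<open>X 0\<close> be the greatest
  one and let the other \<open>X i\<close> be the maximal sets attaining \<open>2|X| - 3\<close> that are not contained in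
  \<open>X 0\<close>. Submodularity makes this family 1-thin, maximality makes it a cover of the graph without the
  loops outside \<open>X 0\<close>, and its value is the size of the sparse set. Conversely the rows induced by
  \<open>X 0\<close> have rank at most \<open>2|X 0|\<close>, and the edges induced by \<open>X i\<close> have rank at most \<open>2|X i| - 3\<close>
  because of the three-dimensional space of infinitesimal isometries.
\<close>

section \<open>Row elimination\<close>

lemma rows_independentD:
  assumes "rows_independent M R C" "r \<in> R" "\<And>j. j \<in> C \<Longrightarrow> (\<Sum>r\<in>R. a r * M r j) = 0"
  shows "a r = 0"
  using assms unfolding rows_independent_def by blast

text \<open>One step of Gaussian elimination with pivot entry \<open>M s c\<close>. If the pivot is
  nonzero, row \<open>s\<close> itself becomes zero, which is why it is dropped from the index set
  afterwards.\<close>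

definition eliminate :: "('r \<Rightarrow> 'c \<Rightarrow> real) \<Rightarrow> 'r \<Rightarrow> 'c \<Rightarrow> 'r \<Rightarrow> 'c \<Rightarrow> real" where
  "eliminate M s c r j = M r j - M r c / M s c * M s j"

lemma eliminate_pivot_column: "M s c \<noteq> 0 \<Longrightarrow> eliminate M s c r c = 0"
  by (simp add: eliminate_def)

text \<open>Dependencies correspond: one among the reduced rows extends to row \<open>s\<close> with
  a suitable coefficient, and in one among the original rows column \<open>c\<close> determines the
  coefficient of \<open>s\<close> from the others.\<close>

lemma rows_independent_eliminate:
  assumes "finite R" "s \<in> R" "c \<in> C" and nz: "M s c \<noteq> 0"
  shows "rows_independent M R C \<longleftrightarrow> rows_independent (eliminate M s c) (R - {s}) C"
proof -
  have split: "(\<Sum>r\<in>R. a r * M r j) = (\<Sum>r\<in>R-{s}. a r * M r j) + a s * M s j" for a j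
    using assms by (simp add: sum.remove)
  have elim: "(\<Sum>r\<in>R-{s}. a r * eliminate M s c r j) =
      (\<Sum>r\<in>R-{s}. a r * M r j) - (\<Sum>r\<in>R-{s}. a r * M r c) / M s c * M s j" for a j
    by (simp add: eliminate_def algebra_simps sum_subtractf sum_distrib_left sum_divide_distrib)
  show ?thesis
  proof
    assume ind: "rows_independent M R C"
    show "rows_independent (eliminate M s c) (R - {s}) C"
      unfolding rows_independent_def
    proof (intro allI impI ballI)
      fix a r
      assume z: "\<forall>j\<in>C. (\<Sum>r\<in>R - {s}. a r * eliminate M s c r j) = 0" and r: "r \<in> R - {s}"
      \<comment> \<open>This coefficient makes up for the multiples of row \<open>s\<close> that
        elimination subtracted from the other rows.\<close>
      let ?a = "a(s := - (\<Sum>r\<in>R-{s}. a r * M r c) / M s c)"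
      have "(\<Sum>r\<in>R. ?a r * M r j) = 0" if "j \<in> C" for j
      proof -
        have "(\<Sum>r\<in>R-{s}. ?a r * M r j) = (\<Sum>r\<in>R-{s}. a r * M r j)"
          by (intro sum.cong) auto
        then show ?thesis using z that elim[of a j] split[of ?a j] by simp
      qed
      then have "\<forall>r\<in>R. ?a r = 0" using ind unfolding rows_independent_def by blast
      then have "?a r = 0" using r by blast
      then show "a r = 0" using r by simp
    qed
  next
    assume ind: "rows_independent (eliminate M s c) (R - {s}) C"
    show "rows_independent M R C"
      unfolding rows_independent_def
    proof (intro allI impI)
      fix a assume z: "\<forall>j\<in>C. (\<Sum>r\<in>R. a r * M r j) = 0"
      have pivot: "(\<Sum>r\<in>R-{s}. a r * M r c) = - a s * M s c"
        using z \<open>c \<in> C\<close> split[of a c] by simp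
      have "(\<Sum>r\<in>R-{s}. a r * eliminate M s c r j) = 0" if "j \<in> C" for j
        using z that split[of a j] nz unfolding elim pivot by simp
      then have *: "\<forall>r\<in>R-{s}. a r = 0" using ind unfolding rows_independent_def by blast
      then have "a s = 0" using pivot nz by simp
      then show "\<forall>r\<in>R. a r = 0" using * by blast
    qed
  qed
qed

lemma rows_independent_nonzero_entry:
  assumes "rows_independent M R C" "finite R" "s \<in> R"
  obtains c where "c \<in> C" "M s c \<noteq> 0"
proof (rule ccontr)
  assume "\<not> thesis"
  then have z: "\<forall>c\<in>C. M s c = 0" using that by blast
  have "(if s = s then 1 else 0 :: real) = 0"
    by (rule rows_independentD[OF assms(1,3), where a = "\<lambda>r. if r = s then 1 else 0"])
       (use z in \<open>auto intro!: sum.neutral\<close>)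
  then show False by simp
qed

lemma rows_independent_fewer_columns:
  assumes "rows_independent M R C"
    and "\<And>a j. \<forall>i\<in>D. (\<Sum>r\<in>R. a r * M r i) = 0 \<Longrightarrow> j \<in> C \<Longrightarrow> (\<Sum>r\<in>R. a r * M r j) = 0"
  shows "rows_independent M R D"
  using assms unfolding rows_independent_def by blast

text \<open>Each pivot removes one row and one column.\<close>

lemma rows_independent_card_le:
  assumes "finite R" "finite C" "rows_independent M R C"
  shows "card R \<le> card C"
  using assms
proof (induction "card R" arbitrary: R C M)
  case (Suc n)
  then obtain s where s: "s \<in> R" by fastforce
  obtain c where c: "c \<in> C" "M s c \<noteq> 0"
    using rows_independent_nonzero_entry[OF Suc.prems(3,1) s] by blast
  have "rows_independent (eliminate M s c) (R - {s}) C"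
    using rows_independent_eliminate[of R s c C M] Suc.prems s c by blast
  then have ind: "rows_independent (eliminate M s c) (R - {s}) (C - {c})"
  proof (rule rows_independent_fewer_columns)
    fix a j
    assume "\<forall>i\<in>C - {c}. (\<Sum>r\<in>R - {s}. a r * eliminate M s c r i) = 0" "j \<in> C"
    then show "(\<Sum>r\<in>R - {s}. a r * eliminate M s c r j) = 0"
      using eliminate_pivot_column[of M s c] c(2) by (cases "j = c") auto
  qed
  have "card (R - {s}) \<le> card (C - {c})"
    using Suc.hyps(2) Suc.prems s ind by (intro Suc.hyps(1)) simp_all
  moreover have "card C > 0" using c Suc.prems by (auto simp: card_gt_0_iff)
  ultimately show ?case using Suc.prems s c by (simp add: card_Diff_singleton)
qed simp

text \<open>Openness of independence, by induction along the elimination: a nonzero pivot stays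
  nonzero in the limit process, and the reduced entries are continuous where the pivot is
  nonzero.\<close>

lemma eventually_rows_independent:
  assumes "finite R" "rows_independent M R C"
    and lim: "\<And>r j. r \<in> R \<Longrightarrow> j \<in> C \<Longrightarrow> ((\<lambda>n. N n r j) \<longlongrightarrow> M r j) F"
  shows "eventually (\<lambda>n. rows_independent (N n) R C) F"
  using assms
proof (induction "card R" arbitrary: R M N)
  case 0
  then show ?case by (simp add: rows_independent_def)
next
  case (Suc n)
  then obtain s where s: "s \<in> R" by fastforce
  obtain c where c: "c \<in> C" "M s c \<noteq> 0"
    using rows_independent_nonzero_entry[OF Suc.prems(2,1) s] by blast
  have "eventually (\<lambda>n. rows_independent (eliminate (N n) s c) (R - {s}) C) F"
  proof (rule Suc.hyps(1))
    show "rows_independent (eliminate M s c) (R - {s}) C"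
      using rows_independent_eliminate[of R s c C M] Suc.prems s c by blast
    show "((\<lambda>n. eliminate (N n) s c r j) \<longlongrightarrow> eliminate M s c r j) F"
      if "r \<in> R - {s}" "j \<in> C" for r j
      unfolding eliminate_def using that s c by (intro tendsto_intros Suc.prems(3)) auto
  qed (use Suc.hyps(2) Suc.prems s in simp_all)
  moreover have "eventually (\<lambda>n. N n s c \<noteq> 0) F"
    using tendsto_imp_eventually_ne[OF Suc.prems(3)[OF s c(1)] c(2)] .
  ultimately show ?case
  proof eventually_elim
    case (elim n)
    then show ?case using rows_independent_eliminate[of R s c C "N n"] Suc.prems(1) s c by blast
  qed
qed

lemma rows_independent_subset:
  assumes "rows_independent M R C" "finite R" "S \<subseteq> R"
  shows "rows_independent M S C"
  unfolding rows_independent_def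
proof (intro allI impI ballI)
  fix a r assume z: "\<forall>j\<in>C. (\<Sum>r\<in>S. a r * M r j) = 0" and r: "r \<in> S"
  have "(\<Sum>r\<in>R. (if r \<in> S then a r else 0) * M r j) = (\<Sum>r\<in>S. a r * M r j)" for j
    using assms by (intro sum.mono_neutral_cong_right) auto
  then have "(if r \<in> S then a r else 0) = 0"
    using z r assms(3)
    by (intro rows_independentD[OF assms(1), where a = "\<lambda>r. if r \<in> S then a r else 0"]) auto
  then show "a r = 0" using r by simp
qed

section \<open>Density of generic points\<close>

text \<open>A finitely supported map is determined by the finite graph of its nonzero values, and a
  countable set has only countably many finite subsets.\<close>

lemma countable_poly_mapping_keys_subset:
  fixes S :: "'a set"
  assumes "countable S"
  shows "countable {P :: 'a \<Rightarrow>\<^sub>0 'b::{countable,zero}. Poly_Mapping.keys P \<subseteq> S}"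
proof -
  let ?g = "\<lambda>P :: 'a \<Rightarrow>\<^sub>0 'b. (\<lambda>k. (k, Poly_Mapping.lookup P k)) ` Poly_Mapping.keys P"
  have "inj ?g"
  proof (rule injI)
    fix P Q :: "'a \<Rightarrow>\<^sub>0 'b" assume eq: "?g P = ?g Q"
    have in_iff: "(k, c) \<in> ?g P \<longleftrightarrow> c \<noteq> 0 \<and> Poly_Mapping.lookup P k = c" for k c and P :: "'a \<Rightarrow>\<^sub>0 'b"
      by (auto simp: in_keys_iff)
    show "P = Q"
    proof (rule poly_mapping_eqI)
      fix k
      show "Poly_Mapping.lookup P k = Poly_Mapping.lookup Q k"
        using in_iff[of k "Poly_Mapping.lookup P k" P] in_iff[of k "Poly_Mapping.lookup P k" Q]
          in_iff[of k "Poly_Mapping.lookup Q k" P] in_iff[of k "Poly_Mapping.lookup Q k" Q]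
        unfolding eq by argo
    qed
  qed
  then have "inj_on ?g {P. Poly_Mapping.keys P \<subseteq> S}" by (rule inj_on_subset) simp
  moreover have "countable (?g ` {P. Poly_Mapping.keys P \<subseteq> S})"
  proof (rule countable_subset)
    show "?g ` {P. Poly_Mapping.keys P \<subseteq> S} \<subseteq> {A. finite A \<and> A \<subseteq> S \<times> UNIV}" by auto
    show "countable {A. finite A \<and> A \<subseteq> S \<times> (UNIV :: 'b set)}"
      using assms by (intro countable_Collect_finite_subset countable_SIGMA) auto
  qed
  ultimately show ?thesis using countable_image_inj_on by blast
qed

section \<open>Polynomials read in one distinguished variable\<close>

definition monom_val :: "('i \<Rightarrow> real) \<Rightarrow> ('i \<Rightarrow>\<^sub>0 nat) \<Rightarrow> real" where
  "monom_val x m = (\<Prod>i\<in>Poly_Mapping.keys m. x i ^ Poly_Mapping.lookup m i)"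

lemma eval_poly_monom_val:
  "eval_poly x P = (\<Sum>m\<in>Poly_Mapping.keys P. of_rat (Poly_Mapping.lookup P m) * monom_val x m)"
  by (simp add: eval_poly_def monom_val_def)

lemma monom_val_add_single:
  assumes "i \<notin> Poly_Mapping.keys m"
  shows "monom_val (x(i := t)) (m + Poly_Mapping.single i d) = monom_val x m * t ^ d"
proof (cases "d = 0")
  case True
  then show ?thesis using assms by (auto simp: monom_val_def intro!: prod.cong)
next
  case False
  have keys: "Poly_Mapping.keys (m + Poly_Mapping.single i d) = insert i (Poly_Mapping.keys m)"
    using False assms by (auto simp: in_keys_iff lookup_add lookup_single when_def split: if_splits)
  have "(\<Prod>j\<in>Poly_Mapping.keys m. (x(i := t)) j ^ Poly_Mapping.lookup (m + Poly_Mapping.single i d) j) =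
      (\<Prod>j\<in>Poly_Mapping.keys m. x j ^ Poly_Mapping.lookup m j)"
    using assms by (intro prod.cong) (auto simp: lookup_add lookup_single when_def)
  moreover have "Poly_Mapping.lookup m i = 0" using assms by (simp add: in_keys_iff)
  ultimately show ?thesis using assms by (simp add: monom_val_def keys lookup_add)
qed

definition drop_var :: "'i \<Rightarrow> ('i \<Rightarrow>\<^sub>0 nat) \<Rightarrow> ('i \<Rightarrow>\<^sub>0 nat)" where
  "drop_var i m = m - Poly_Mapping.single i (Poly_Mapping.lookup m i)"

lemma drop_var_add: "drop_var i m + Poly_Mapping.single i (Poly_Mapping.lookup m i) = m"
  by (rule poly_mapping_eqI) (simp add: drop_var_def lookup_add lookup_minus lookup_single when_def)

lemma keys_drop_var: "Poly_Mapping.keys (drop_var i m) = Poly_Mapping.keys m - {i}"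
  by (auto simp: drop_var_def in_keys_iff lookup_minus lookup_single when_def split: if_splits)

text \<open>The coefficient of the \<open>d\<close>-th power of variable \<open>i\<close> when
  \<open>P\<close> is read as a polynomial in \<open>i\<close> over the polynomials in the other
  variables. The test on \<open>Poly_Mapping.keys m\<close> keeps terms of higher degree in
  \<open>i\<close> from leaking in.\<close>

definition coeff_var :: "'i \<Rightarrow> nat \<Rightarrow> (('i \<Rightarrow>\<^sub>0 nat) \<Rightarrow>\<^sub>0 rat) \<Rightarrow> (('i \<Rightarrow>\<^sub>0 nat) \<Rightarrow>\<^sub>0 rat)" where
  "coeff_var i d P = Abs_poly_mapping
     (\<lambda>m. if i \<in> Poly_Mapping.keys m then 0 else Poly_Mapping.lookup P (m + Poly_Mapping.single i d))"

lemma lookup_coeff_var: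
  "Poly_Mapping.lookup (coeff_var i d P) m =
     (if i \<in> Poly_Mapping.keys m then 0 else Poly_Mapping.lookup P (m + Poly_Mapping.single i d))"
proof -
  have "finite {m. (if i \<in> Poly_Mapping.keys m then 0
      else Poly_Mapping.lookup P (m + Poly_Mapping.single i d)) \<noteq> 0}"
  proof (rule finite_subset)
    show "{m. (if i \<in> Poly_Mapping.keys m then 0
        else Poly_Mapping.lookup P (m + Poly_Mapping.single i d)) \<noteq> 0}
        \<subseteq> (\<lambda>m. m - Poly_Mapping.single i d) ` Poly_Mapping.keys P"
    proof
      fix m assume "m \<in> {m. (if i \<in> Poly_Mapping.keys m then 0
        else Poly_Mapping.lookup P (m + Poly_Mapping.single i d)) \<noteq> 0}"
      then have "m + Poly_Mapping.single i d \<in> Poly_Mapping.keys P"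
        by (auto simp: in_keys_iff split: if_splits)
      then show "m \<in> (\<lambda>m. m - Poly_Mapping.single i d) ` Poly_Mapping.keys P"
        by (rule rev_image_eqI) simp
    qed
  qed simp
  then show ?thesis by (simp add: coeff_var_def lookup_Abs_poly_mapping)
qed

lemma eval_poly_coeff_var:
  "eval_poly x (coeff_var i d P) =
     (\<Sum>m | m \<in> Poly_Mapping.keys P \<and> Poly_Mapping.lookup m i = d.
        of_rat (Poly_Mapping.lookup P m) * monom_val x (drop_var i m))"
  unfolding eval_poly_monom_val
proof (rule sum.reindex_bij_witness[where i = "drop_var i" and j = "\<lambda>m. m + Poly_Mapping.single i d"])
  have drop: "drop_var i (m + Poly_Mapping.single i d) = m" if "i \<notin> Poly_Mapping.keys m" for m
    using that by (intro poly_mapping_eqI)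
      (auto simp: drop_var_def lookup_add lookup_minus lookup_single when_def in_keys_iff)
  fix m
  {
    assume "m \<in> Poly_Mapping.keys (coeff_var i d P)"
    then have m: "i \<notin> Poly_Mapping.keys m" "m + Poly_Mapping.single i d \<in> Poly_Mapping.keys P"
      by (auto simp: in_keys_iff lookup_coeff_var split: if_splits)
    show "drop_var i (m + Poly_Mapping.single i d) = m" using drop m by blast
    show "m + Poly_Mapping.single i d \<in> {m \<in> Poly_Mapping.keys P. Poly_Mapping.lookup m i = d}"
      using m by (simp add: lookup_add in_keys_iff)
    show "of_rat (Poly_Mapping.lookup P (m + Poly_Mapping.single i d)) *
        monom_val x (drop_var i (m + Poly_Mapping.single i d)) =
        of_rat (Poly_Mapping.lookup (coeff_var i d P) m) * monom_val x m"
      using m drop[of m] by (simp add: lookup_coeff_var)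
  }
  assume "m \<in> {m \<in> Poly_Mapping.keys P. Poly_Mapping.lookup m i = d}"
  then have m: "m \<in> Poly_Mapping.keys P" "Poly_Mapping.lookup m i = d" by auto
  show "drop_var i m + Poly_Mapping.single i d = m" using drop_var_add[of i m] m by simp
  then show "drop_var i m \<in> Poly_Mapping.keys (coeff_var i d P)"
    using m by (auto simp: in_keys_iff lookup_coeff_var keys_drop_var)
qed

text \<open>Grouping the monomials by their exponent of \<open>i\<close> gives a univariate real
  polynomial in \<open>t\<close>. The inserted \<open>0\<close> keeps \<open>Max\<close> meaningful
  when \<open>P\<close> has no monomials.\<close>

lemma eval_poly_fun_upd:
  "eval_poly (x(i := t)) P =
     (\<Sum>d\<le>Max (insert 0 ((\<lambda>m. Poly_Mapping.lookup m i) ` Poly_Mapping.keys P)).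
        eval_poly x (coeff_var i d P) * t ^ d)" (is "_ = (\<Sum>d\<le>?D. _)")
proof -
  have "eval_poly (x(i := t)) P =
      (\<Sum>m\<in>Poly_Mapping.keys P. of_rat (Poly_Mapping.lookup P m) *
        (monom_val x (drop_var i m) * t ^ Poly_Mapping.lookup m i))"
    unfolding eval_poly_monom_val
  proof (intro sum.cong refl arg_cong2[where f = "(*)"])
    fix m
    show "monom_val (x(i := t)) m = monom_val x (drop_var i m) * t ^ Poly_Mapping.lookup m i"
      using monom_val_add_single[of i "drop_var i m" x t "Poly_Mapping.lookup m i"]
      by (simp add: keys_drop_var drop_var_add)
  qed
  also have "\<dots> = (\<Sum>d\<le>?D. \<Sum>m | m \<in> Poly_Mapping.keys P \<and> Poly_Mapping.lookup m i = d.
      of_rat (Poly_Mapping.lookup P m) * (monom_val x (drop_var i m) * t ^ Poly_Mapping.lookup m i))"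
    by (rule sum.group[symmetric]) (auto intro!: Max_ge)
  also have "\<dots> = (\<Sum>d\<le>?D. eval_poly x (coeff_var i d P) * t ^ d)"
    unfolding eval_poly_coeff_var sum_distrib_right by (intro sum.cong refl) auto
  finally show ?thesis .
qed

lemma coeff_var_eq_0_imp:
  assumes "\<And>d. coeff_var i d P = 0"
  shows "P = 0"
proof (rule poly_mapping_eqI)
  fix m
  have "Poly_Mapping.lookup P m =
      Poly_Mapping.lookup (coeff_var i (Poly_Mapping.lookup m i) P) (drop_var i m)"
    by (simp add: lookup_coeff_var keys_drop_var drop_var_add)
  then show "Poly_Mapping.lookup P m = Poly_Mapping.lookup 0 m" using assms by simp
qed

text \<open>Only countably many polynomials can witness a dependence. Each has some nonzero
  \<open>coeff_var i d P\<close>, which involves variables of \<open>I\<close> only and so does not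
  vanish at \<open>x\<close>; hence it is a nonzero polynomial in \<open>t\<close> and has finitely
  many roots.\<close>

lemma algebraically_independent_insert:
  assumes "algebraically_independent x I" "finite I" "i \<notin> I"
  shows "countable {t. \<not> algebraically_independent (x(i := t)) (insert i I)}"
proof -
  define S where "S = {P :: ('a \<Rightarrow>\<^sub>0 nat) \<Rightarrow>\<^sub>0 rat. P \<noteq> 0 \<and>
      (\<forall>m\<in>Poly_Mapping.keys P. Poly_Mapping.keys m \<subseteq> insert i I)}"
  have "countable S"
  proof (rule countable_subset)
    show "S \<subseteq> {P. Poly_Mapping.keys P \<subseteq> {m. Poly_Mapping.keys m \<subseteq> insert i I}}"
      by (auto simp: S_def)
    show "countable {P :: ('a \<Rightarrow>\<^sub>0 nat) \<Rightarrow>\<^sub>0 rat. Poly_Mapping.keys P \<subseteq> {m. Poly_Mapping.keys m \<subseteq> insert i I}}"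
      using assms(2) by (intro countable_poly_mapping_keys_subset countable_finite) auto
  qed
  moreover have "finite {t. eval_poly (x(i := t)) P = 0}" if P: "P \<in> S" for P
  proof -
    let ?D = "Max (insert 0 ((\<lambda>m. Poly_Mapping.lookup m i) ` Poly_Mapping.keys P))"
    obtain d where d: "coeff_var i d P \<noteq> 0"
      using P coeff_var_eq_0_imp[of i P] by (auto simp: S_def)
    then obtain m where m: "Poly_Mapping.lookup (coeff_var i d P) m \<noteq> 0"
      using poly_mapping_eqI[of "coeff_var i d P" 0] by auto
    then have "m + Poly_Mapping.single i d \<in> Poly_Mapping.keys P" "i \<notin> Poly_Mapping.keys m"
      by (auto simp: lookup_coeff_var in_keys_iff split: if_splits)
    then have "d \<in> (\<lambda>m. Poly_Mapping.lookup m i) ` Poly_Mapping.keys P"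
      by (auto simp: image_iff in_keys_iff lookup_add intro!: bexI[of _ "m + Poly_Mapping.single i d"])
    then have dD: "d \<le> ?D" by (intro Max_ge) auto
    have "Poly_Mapping.keys m' \<subseteq> I" if "m' \<in> Poly_Mapping.keys (coeff_var i d P)" for m'
    proof -
      have m': "m' + Poly_Mapping.single i d \<in> Poly_Mapping.keys P" "i \<notin> Poly_Mapping.keys m'"
        using that by (auto simp: lookup_coeff_var in_keys_iff split: if_splits)
      have "Poly_Mapping.keys m' \<subseteq> Poly_Mapping.keys (m' + Poly_Mapping.single i d)"
        by (auto simp: in_keys_iff lookup_add)
      then show ?thesis using m' P unfolding S_def by blast
    qed
    then have "eval_poly x (coeff_var i d P) \<noteq> 0"
      using assms(1) d unfolding algebraically_independent_def by blast
    then show ?thesis unfolding eval_poly_fun_upd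
      using dD by (intro polyfun_roots_finite[where k = d]) 
  qed
  ultimately have "countable (\<Union>P\<in>S. {t. eval_poly (x(i := t)) P = 0})"
    by (intro countable_UN) (auto intro: countable_finite)
  then show ?thesis
    by (rule countable_subset[rotated]) (auto simp: algebraically_independent_def S_def)
qed

text \<open>Coordinates are chosen one after another: the open interval allowed for the next one is
  uncountable, while the values to be avoided are countable.\<close>

lemma algebraically_independent_dense:
  assumes "finite I" "\<epsilon> > 0"
  shows "\<exists>y. algebraically_independent y I \<and> (\<forall>i\<in>I. \<bar>y i - x i\<bar> < \<epsilon>)"
  using assms(1)
proof (induction I)
  case empty
  \<comment> \<open>Without variables \<open>P\<close> is a rational constant, and its value is that
    constant.\<close>
  have "P = 0" if "\<forall>m\<in>Poly_Mapping.keys P. Poly_Mapping.keys m \<subseteq> {}" "eval_poly x P = 0" for P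
  proof (rule poly_mapping_eqI)
    have keys: "Poly_Mapping.keys P \<subseteq> {0}" using that(1) by auto
    have "eval_poly x P = (\<Sum>m\<in>{0}. of_rat (Poly_Mapping.lookup P m) * monom_val x m)"
      unfolding eval_poly_monom_val using keys by (intro sum.mono_neutral_left) (auto simp: in_keys_iff)
    then have "Poly_Mapping.lookup P 0 = 0" using that(2) by (simp add: monom_val_def)
    then show "Poly_Mapping.lookup P m = Poly_Mapping.lookup 0 m" for m
      using keys by (cases "m = 0") (auto simp: in_keys_iff)
  qed
  then show ?case by (auto simp: algebraically_independent_def)
next
  case (insert i I)
  then obtain y where y: "algebraically_independent y I" "\<forall>j\<in>I. \<bar>y j - x j\<bar> < \<epsilon>" by blast
  have "uncountable {x i - \<epsilon> <..< x i + \<epsilon>}"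
    using assms(2) by (simp add: uncountable_open_interval)
  then obtain t where t: "t \<in> {x i - \<epsilon> <..< x i + \<epsilon>}" "algebraically_independent (y(i := t)) (insert i I)"
    using countable_subset[OF _ algebraically_independent_insert[OF y(1) insert(1,2)]] by blast
  have "\<bar>(y(i := t)) j - x j\<bar> < \<epsilon>" if "j \<in> insert i I" for j
    using that t(1) y(2) by (cases "j = i") (auto simp: abs_less_iff)
  then show ?case using t(2) by blast
qed

lemma generic_dense:
  assumes "finite (verts G)" "finite (loops G)" "\<epsilon> > 0"
  shows "\<exists>p' q'. generic G p' q' \<and> (\<forall>v\<in>verts G. \<forall>i. \<bar>p' v $ i - p v $ i\<bar> < \<epsilon>) \<and>
    (\<forall>l\<in>loops G. \<forall>i. \<bar>q' l $ i - q l $ i\<bar> < \<epsilon>)"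
proof -
  let ?I = "(verts G \<times> (UNIV :: 2 set)) <+> (loops G \<times> (UNIV :: 2 set))"
  obtain y where y: "algebraically_independent y ?I" "\<forall>i\<in>?I. \<bar>y i - coords p q i\<bar> < \<epsilon>"
    using algebraically_independent_dense[of ?I \<epsilon> "coords p q"] assms by auto
  define p' q' where "p' = (\<lambda>v. \<chi> i. y (Inl (v, i)))" and "q' = (\<lambda>l. \<chi> i. y (Inr (l, i)))"
  have c: "coords p' q' = y"
  proof
    fix j show "coords p' q' j = y j"
      by (cases j) (auto simp: p'_def q'_def)
  qed
  have "\<bar>p' v $ i - p v $ i\<bar> < \<epsilon>" if "v \<in> verts G" for v i
    using y(2)[THEN bspec, of "Inl (v, i)"] that by (auto simp: p'_def)
  moreover have "\<bar>q' l $ i - q l $ i\<bar> < \<epsilon>" if "l \<in> loops G" for l i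
    using y(2)[THEN bspec, of "Inr (l, i)"] that by (auto simp: q'_def)
  moreover have "generic G p' q'" using y(1) by (simp add: generic_def c)
  ultimately show ?thesis by blast
qed

section \<open>Stresses\<close>

definition edges_on :: "'v set \<Rightarrow> 'v set set \<Rightarrow> bool" where
  "edges_on V E \<longleftrightarrow> (\<forall>e\<in>E. e \<subseteq> V \<and> card e = 2)"

text \<open>The two entries in the columns of \<open>v\<close> of a linear combination of matrix
  rows, with coefficients \<open>\<omega>\<close> on edges and \<open>\<mu>\<close> on loops.
  Summing over all \<open>u\<close> in \<open>V\<close> is correct when \<open>\<omega>\<close>
  vanishes off the edge set; the term \<open>u = v\<close> is zero.\<close>

definition stress_force ::
  "'v set \<Rightarrow> 'l set \<Rightarrow> ('l \<Rightarrow> 'v) \<Rightarrow> ('v \<Rightarrow> real^2) \<Rightarrow> ('l \<Rightarrow> real^2) \<Rightarrow>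
   ('v set \<Rightarrow> real) \<Rightarrow> ('l \<Rightarrow> real) \<Rightarrow> 'v \<Rightarrow> real^2" where
  "stress_force V L b p q \<omega> \<mu> v =
     (\<Sum>u\<in>V. \<omega> {u, v} *\<^sub>R (p v - p u)) + (\<Sum>l\<in>L. if b l = v then \<mu> l *\<^sub>R q l else 0)"

definition stress_free ::
  "'v set \<Rightarrow> 'v set set \<Rightarrow> 'l set \<Rightarrow> ('l \<Rightarrow> 'v) \<Rightarrow> ('v \<Rightarrow> real^2) \<Rightarrow> ('l \<Rightarrow> real^2) \<Rightarrow> bool" where
  "stress_free V E L b p q \<longleftrightarrow>
     (\<forall>\<omega> \<mu>. (\<forall>e. e \<notin> E \<longrightarrow> \<omega> e = 0) \<longrightarrow> (\<forall>v\<in>V. stress_force V L b p q \<omega> \<mu> v = 0) \<longrightarrow>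
        (\<forall>e\<in>E. \<omega> e = 0) \<and> (\<forall>l\<in>L. \<mu> l = 0))"

lemma stress_freeD:
  assumes "stress_free V E L b p q" "\<And>e. e \<notin> E \<Longrightarrow> \<omega> e = 0"
    "\<And>v. v \<in> V \<Longrightarrow> stress_force V L b p q \<omega> \<mu> v = 0"
  shows "e \<in> E \<Longrightarrow> \<omega> e = 0" "l \<in> L \<Longrightarrow> \<mu> l = 0"
  using assms unfolding stress_free_def by blast+

lemma stress_freeI:
  assumes "\<And>\<omega> \<mu>. (\<And>e. e \<notin> E \<Longrightarrow> \<omega> e = 0) \<Longrightarrow> (\<And>v. v \<in> V \<Longrightarrow> stress_force V L b p q \<omega> \<mu> v = 0) \<Longrightarrow>
    (\<forall>e\<in>E. \<omega> e = 0) \<and> (\<forall>l\<in>L. \<mu> l = 0)"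
  shows "stress_free V E L b p q"
  using assms unfolding stress_free_def by blast

lemma edges_on_finite: "finite V \<Longrightarrow> edges_on V E \<Longrightarrow> finite E"
  by (rule finite_subset[of _ "Pow V"]) (auto simp: edges_on_def)

lemma the_elem_pair_diff: "u \<noteq> v \<Longrightarrow> the_elem ({u, v} - {v}) = u"
  by (metis Diff_insert_absorb empty_iff insert_Diff_if insert_iff singleton_iff the_elem_eq)

lemma edges_on_cases:
  assumes "edges_on V E" "e \<in> E" "v \<in> e"
  obtains u where "u \<in> V" "u \<noteq> v" "e = {u, v}"
proof -
  have "card e = 2" "e \<subseteq> V" using assms by (auto simp: edges_on_def)
  then obtain x y where "e = {x, y}" "x \<noteq> y" by (auto simp: card_2_iff)
  then show thesis using that[of x] that[of y] assms(3) \<open>e \<subseteq> V\<close> by (auto simp: insert_commute)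
qed

lemma edges_on_pair: "edges_on V E \<Longrightarrow> {u, v} \<in> E \<Longrightarrow> u \<in> V \<and> v \<in> V \<and> u \<noteq> v"
  by (fastforce simp: edges_on_def)

text \<open>The edges at \<open>v\<close> correspond bijectively to their other endpoints, so a sum
  over rows becomes a sum over vertices.\<close>

lemma rigidity_row_sum:
  assumes "finite V" "finite L" "edges_on V E" "v \<in> V"
  shows "(\<Sum>r\<in>E <+> L. a r * rigidity_matrix G p q r (v, i)) =
    stress_force V L (base G) p q (\<lambda>e. if e \<in> E then a (Inl e) else 0) (\<lambda>l. a (Inr l)) v $ i"
proof -
  note fE = edges_on_finite[OF assms(1,3)]
  let ?N = "{u \<in> V. {u, v} \<in> E}"
  have "(\<Sum>e\<in>E. a (Inl e) * rigidity_matrix G p q (Inl e) (v, i)) =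
      (\<Sum>e | e \<in> E \<and> v \<in> e. a (Inl e) * (p v - p (the_elem (e - {v}))) $ i)"
    using fE by (intro sum.mono_neutral_cong_right) auto
  also have "\<dots> = (\<Sum>u\<in>?N. a (Inl {u, v}) * (p v - p u) $ i)"
  proof (rule sum.reindex_bij_witness[where i = "\<lambda>u. {u, v}" and j = "\<lambda>e. the_elem (e - {v})"])
    fix e assume "e \<in> {e. e \<in> E \<and> v \<in> e}"
    then obtain u where u: "u \<in> V" "u \<noteq> v" "e = {u, v}" "e \<in> E"
      using edges_on_cases[OF assms(3), of e v] by blast
    then have t: "the_elem (e - {v}) = u" using the_elem_pair_diff by metis
    show "{the_elem (e - {v}), v} = e" "the_elem (e - {v}) \<in> ?N" using t u by auto
    show "a (Inl {the_elem (e - {v}), v}) * (p v - p (the_elem (e - {v}))) $ i =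
        a (Inl e) * (p v - p (the_elem (e - {v}))) $ i" using t u by simp
  next
    fix u assume "u \<in> ?N"
    then have u: "u \<noteq> v" "{u, v} \<in> E" using edges_on_pair[OF assms(3)] by auto
    then show "the_elem ({u, v} - {v}) = u" "{u, v} \<in> {e. e \<in> E \<and> v \<in> e}"
      using the_elem_pair_diff[of u v] by auto
  qed
  also have "\<dots> = (\<Sum>u\<in>V. (if {u, v} \<in> E then a (Inl {u, v}) else 0) * (p v - p u) $ i)"
    using assms(1) by (intro sum.mono_neutral_cong_left) auto
  finally have "(\<Sum>e\<in>E. a (Inl e) * rigidity_matrix G p q (Inl e) (v, i)) =
     (\<Sum>u\<in>V. (if {u, v} \<in> E then a (Inl {u, v}) else 0) * (p v - p u) $ i)" .
  moreover have "(\<Sum>l\<in>L. a (Inr l) * rigidity_matrix G p q (Inr l) (v, i)) =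
      (\<Sum>l\<in>L. if base G l = v then a (Inr l) *\<^sub>R q l else 0) $ i"
    by (simp only: sum_component) (auto intro!: sum.cong)
  ultimately show ?thesis
    using fE assms(2) by (simp add: sum.Plus stress_force_def sum_component)
qed

lemma rows_independent_iff_stress_free:
  assumes "finite V" "finite L" "edges_on V E"
  shows "rows_independent (rigidity_matrix G p q) (E <+> L) (V \<times> UNIV) \<longleftrightarrow>
    stress_free V E L (base G) p q"
proof
  assume ind: "rows_independent (rigidity_matrix G p q) (E <+> L) (V \<times> UNIV)"
  show "stress_free V E L (base G) p q"
  proof (rule stress_freeI)
    fix \<omega> \<mu>
    assume supp: "\<And>e. e \<notin> E \<Longrightarrow> \<omega> e = 0"
      and eq: "\<And>v. v \<in> V \<Longrightarrow> stress_force V L (base G) p q \<omega> \<mu> v = 0"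
    have \<omega>: "(\<lambda>e. if e \<in> E then case_sum \<omega> \<mu> (Inl e) else 0) = \<omega>" using supp by auto
    have "case_sum \<omega> \<mu> r = 0" if "r \<in> E <+> L" for r
    proof (rule rows_independentD[OF ind that, where a = "case_sum \<omega> \<mu>"])
      fix j :: "'a \<times> 2" assume "j \<in> V \<times> UNIV"
      then obtain v i where j: "j = (v, i)" "v \<in> V" by auto
      show "(\<Sum>r\<in>E <+> L. case_sum \<omega> \<mu> r * rigidity_matrix G p q r j) = 0"
        unfolding j rigidity_row_sum[OF assms j(2)] \<omega> using eq[OF j(2)] by simp
    qed
    from this[of "Inl _"] this[of "Inr _"] show "(\<forall>e\<in>E. \<omega> e = 0) \<and> (\<forall>l\<in>L. \<mu> l = 0)" by auto
  qed
next
  assume sf: "stress_free V E L (base G) p q"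
  show "rows_independent (rigidity_matrix G p q) (E <+> L) (V \<times> UNIV)"
    unfolding rows_independent_def
  proof (intro allI impI)
    fix a assume z: "\<forall>j\<in>V \<times> UNIV. (\<Sum>r\<in>E <+> L. a r * rigidity_matrix G p q r j) = 0"
    let ?\<omega> = "\<lambda>e. if e \<in> E then a (Inl e) else 0" and ?\<mu> = "\<lambda>l. a (Inr l)"
    have force: "stress_force V L (base G) p q ?\<omega> ?\<mu> v = 0" if "v \<in> V" for v
    proof (subst vec_eq_iff, intro allI)
      fix i :: 2
      have "(v, i) \<in> V \<times> UNIV" using that by simp
      then show "stress_force V L (base G) p q ?\<omega> ?\<mu> v $ i = 0 $ i"
        using z rigidity_row_sum[OF assms that, of a G p q i] by simp
    qed
    have "a (Inl e) = 0" if "e \<in> E" for e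
      using stress_freeD(1)[OF sf, of ?\<omega> ?\<mu>, OF _ force that] that by simp
    moreover have "a (Inr l) = 0" if "l \<in> L" for l
      using stress_freeD(2)[OF sf, of ?\<omega> ?\<mu>, OF _ force that] by simp
    ultimately show "\<forall>r\<in>E <+> L. a r = 0" by auto
  qed
qed

lemma eventually_stress_free:
  assumes "finite V" "finite L" "edges_on V E" "stress_free V E L b p q"
    and "\<And>v. v \<in> V \<Longrightarrow> ((\<lambda>n. P n v) \<longlongrightarrow> p v) F"
    and "\<And>l. l \<in> L \<Longrightarrow> ((\<lambda>n. Q n l) \<longlongrightarrow> q l) F"
  shows "eventually (\<lambda>n. stress_free V E L b (P n) (Q n)) F"
proof -
  \<comment> \<open>Any graph with these components lets the openness of row independence be applied
    to its rigidity matrix.\<close>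
  define G where "G = \<lparr>verts = V, edges = E, loops = L, base = b\<rparr>"
  have b: "base G = b" by (simp add: G_def)
  have "eventually (\<lambda>n. rows_independent (rigidity_matrix G (P n) (Q n)) (E <+> L) (V \<times> UNIV)) F"
  proof (rule eventually_rows_independent)
    show "finite (E <+> L)" using assms edges_on_finite by (intro finite_Plus) auto
    show "rows_independent (rigidity_matrix G p q) (E <+> L) (V \<times> UNIV)"
      using rows_independent_iff_stress_free[OF assms(1-3), of G] assms(4) b by simp
    fix r and j :: "'a \<times> 2" assume r: "r \<in> E <+> L" and "j \<in> V \<times> UNIV"
    then obtain v i where j: "j = (v, i)" "v \<in> V" by auto
    show "((\<lambda>n. rigidity_matrix G (P n) (Q n) r j) \<longlongrightarrow> rigidity_matrix G p q r j) F"
    proof (cases r)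
      case (Inl e)
      show ?thesis
      proof (cases "v \<in> e")
        case True
        then obtain u where u: "u \<in> V" "u \<noteq> v" "e = {u, v}"
          using edges_on_cases[OF assms(3), of e v] r Inl by auto
        then have t: "the_elem (e - {v}) = u" using the_elem_pair_diff by metis
        then have "rigidity_matrix G p' q' r j = (p' v - p' u) $ i" for p' q'
          using True by (simp add: Inl j)
        then show ?thesis using u j assms(5) by (simp add: tendsto_intros)
      qed (simp add: Inl j)
    next
      case (Inr l)
      then show ?thesis using r j assms(6) by (cases "v = base G l") (auto intro!: tendsto_intros)
    qed
  qed
  then show ?thesis using rows_independent_iff_stress_free[OF assms(1-3), of G] b by simp
qed

text \<open>The given placement may be very special, but generic placements converge to it, and by
  openness one of them is stress free as well.\<close>

lemma stress_free_imp_lc_independent: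
  assumes "looped_simple_graph G" "E \<subseteq> edges G" "L \<subseteq> loops G"
    and "stress_free (verts G) E L (base G) p q"
  shows "lc_independent G (E <+> L)"
proof -
  have fin: "finite (verts G)" "finite (loops G)" "finite L" "edges_on (verts G) E"
    using assms by (auto simp: looped_simple_graph_def edges_on_def intro: finite_subset)
  have "\<exists>p' q'. generic G p' q' \<and> (\<forall>v\<in>verts G. \<forall>i. \<bar>p' v $ i - p v $ i\<bar> < inverse (real (Suc n))) \<and>
    (\<forall>l\<in>loops G. \<forall>i. \<bar>q' l $ i - q l $ i\<bar> < inverse (real (Suc n)))" for n
    by (rule generic_dense) (use fin in auto)
  then obtain P Q where PQ: "generic G (P n) (Q n)"
      "\<And>v i. v \<in> verts G \<Longrightarrow> \<bar>P n v $ i - p v $ i\<bar> < inverse (real (Suc n))"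
      "\<And>l i. l \<in> loops G \<Longrightarrow> \<bar>Q n l $ i - q l $ i\<bar> < inverse (real (Suc n))" for n
    by metis
  have lim: "(\<lambda>n. x n) \<longlonglongrightarrow> c" if "\<And>n. \<bar>x n - c\<bar> < inverse (real (Suc n))" for x and c :: real
    unfolding LIM_zero_iff[symmetric, of x]
    by (rule Lim_null_comparison[OF _ LIMSEQ_inverse_real_of_nat])
       (use that in \<open>auto intro!: always_eventually simp: less_imp_le\<close>)
  have "eventually (\<lambda>n. stress_free (verts G) E L (base G) (P n) (Q n)) sequentially"
    using fin assms(3) PQ
    by (intro eventually_stress_free[OF _ _ _ assms(4)] vec_tendstoI lim) auto
  then obtain n where "stress_free (verts G) E L (base G) (P n) (Q n)"
    using eventually_happens'[OF sequentially_bot] by blast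
  then have "rows_independent (rigidity_matrix G (P n) (Q n)) (E <+> L) (verts G \<times> UNIV)"
    using rows_independent_iff_stress_free[OF fin(1,3,4)] by blast
  then show ?thesis using PQ(1) assms(2,3) unfolding lc_independent_def ground_def by auto
qed

section \<open>Extension steps\<close>

text \<open>The determinant of two plane vectors, used to express that they are not parallel and to
  measure torque.\<close>

definition cross2 :: "real^2 \<Rightarrow> real^2 \<Rightarrow> real" where
  "cross2 x y = x $ 1 * y $ 2 - x $ 2 * y $ 1"

lemma cross2_add_left: "cross2 (x + y) z = cross2 x z + cross2 y z"
  and cross2_diff_left: "cross2 (x - y) z = cross2 x z - cross2 y z"
  and cross2_scaleR_left: "cross2 (c *\<^sub>R x) z = c * cross2 x z"
  and cross2_add_right: "cross2 z (x + y) = cross2 z x + cross2 z y"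
  and cross2_diff_right: "cross2 z (x - y) = cross2 z x - cross2 z y"
  and cross2_scaleR_right: "cross2 z (c *\<^sub>R x) = c * cross2 z x"
  and cross2_self: "cross2 x x = 0"
  and cross2_zero_left: "cross2 0 x = 0"
  and cross2_zero_right: "cross2 x 0 = 0"
  by (simp_all add: cross2_def algebra_simps)

lemmas cross2_simps = cross2_add_left cross2_diff_left cross2_scaleR_left cross2_add_right
  cross2_diff_right cross2_scaleR_right cross2_self cross2_zero_left cross2_zero_right

lemma cross2_independent:
  assumes "a *\<^sub>R x + c *\<^sub>R y = 0" "cross2 x y \<noteq> 0"
  shows "a = 0 \<and> c = 0"
proof -
  have "cross2 (a *\<^sub>R x + c *\<^sub>R y) y = a * cross2 x y"
    "cross2 x (a *\<^sub>R x + c *\<^sub>R y) = c * cross2 x y" by (simp_all add: cross2_simps)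
  then show ?thesis using assms by (metis cross2_zero_left cross2_zero_right mult_eq_0_iff)
qed

definition perp :: "real^2 \<Rightarrow> real^2" where
  "perp x = vector [- x $ 2, x $ 1]"

lemma cross2_perp_nonzero: "x \<noteq> 0 \<Longrightarrow> cross2 (perp x) x \<noteq> 0"
proof -
  assume "x \<noteq> 0"
  then have "x $ 1 \<noteq> 0 \<or> x $ 2 \<noteq> 0" by (auto simp: vec_eq_iff forall_2)
  moreover have "cross2 (perp x) x = - (x $ 1 * x $ 1 + x $ 2 * x $ 2)"
    by (simp add: cross2_def perp_def)
  ultimately show ?thesis by (metis neg_equal_0_iff_equal sum_squares_eq_zero_iff)
qed

text \<open>The steps below need a vertex off the line through \<open>c\<close> with direction
  \<open>d\<close>. If \<open>w\<close> lies on it, a small move along \<open>perp d\<close> takes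
  it off, and openness keeps the placement stress free.\<close>

lemma stress_free_perturb:
  assumes "finite V" "finite L" "edges_on V E" "stress_free V E L b p q" "d \<noteq> 0"
  shows "\<exists>z. stress_free V E L b (p(w := z)) q \<and> cross2 (z - c) d \<noteq> 0"
proof (cases "cross2 (p w - c) d = 0")
  case False
  then show ?thesis using assms(4) by (intro exI[of _ "p w"]) simp
next
  case True
  define z where "z n = p w + inverse (real (Suc n)) *\<^sub>R perp d" for n
  have "(\<lambda>n. p w + inverse (real (Suc n)) *\<^sub>R perp d) \<longlonglongrightarrow> p w + 0 *\<^sub>R perp d"
    by (intro tendsto_intros LIMSEQ_inverse_real_of_nat)
  then have z: "z \<longlonglongrightarrow> p w" by (simp add: z_def[abs_def])
  have "(\<lambda>n. (p(w := z n)) v) \<longlonglongrightarrow> p v" for v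
    using z by (cases "v = w") auto
  then have "eventually (\<lambda>n. stress_free V E L b (p(w := z n)) q) sequentially"
    by (intro eventually_stress_free[OF assms(1-4)]) auto
  then obtain n where n: "stress_free V E L b (p(w := z n)) q"
    using eventually_happens'[OF sequentially_bot] by blast
  have "cross2 (z n - c) d = cross2 (p w - c) d + inverse (real (Suc n)) * cross2 (perp d) d"
    by (simp add: z_def cross2_simps)
  then have "cross2 (z n - c) d \<noteq> 0" using True cross2_perp_nonzero[OF assms(5)] by simp
  then show ?thesis using n by blast
qed

lemma stress_free_loop_nonzero:
  assumes "stress_free V E L b p q" "l \<in> L"
  shows "q l \<noteq> 0"
proof
  assume "q l = 0"
  then have "stress_force V L b p q (\<lambda>_. 0) (\<lambda>k. if k = l then 1 else 0) v = 0" for v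
    by (auto simp: stress_force_def intro!: sum.neutral)
  from stress_freeD(2)[OF assms(1) _ this assms(2)] show False by simp
qed

lemma stress_free_edge_nonzero:
  assumes "stress_free V E L b p q" "{x, y} \<in> E"
  shows "p x \<noteq> p y"
proof
  assume "p x = p y"
  then have "(\<Sum>u\<in>V. (if {u, v} = {x, y} then 1 else 0) *\<^sub>R (p v - p u)) = 0" for v
    by (intro sum.neutral) (auto simp: doubleton_eq_iff)
  then have "stress_force V L b p q (\<lambda>e. if e = {x, y} then 1 else 0) (\<lambda>_. 0) v = 0" for v
    by (simp add: stress_force_def sum.neutral)
  from stress_freeD(1)[OF assms(1) _ this assms(2)] assms(2) show False by force
qed

lemma stress_force_remove:
  assumes "finite V" "v \<in> V"
  shows "stress_force V L b p q \<omega> \<mu> x = \<omega> {v, x} *\<^sub>R (p x - p v) +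
    ((\<Sum>u\<in>V - {v}. \<omega> {u, x} *\<^sub>R (p x - p u)) + (\<Sum>l\<in>L. if b l = x then \<mu> l *\<^sub>R q l else 0))"
  unfolding stress_force_def sum.remove[OF assms] by (simp add: add.assoc)

lemma stress_force_neighbours:
  assumes "finite V" "N \<subseteq> V" "\<And>u. u \<in> V \<Longrightarrow> {u, v} \<in> E \<Longrightarrow> u \<in> N" "finite L"
    "\<And>e. e \<notin> E \<Longrightarrow> \<omega> e = 0"
  shows "stress_force V L b p q \<omega> \<mu> v =
    (\<Sum>u\<in>N. \<omega> {u, v} *\<^sub>R (p v - p u)) + (\<Sum>l | l \<in> L \<and> b l = v. \<mu> l *\<^sub>R q l)"
proof -
  have "(\<Sum>u\<in>V. \<omega> {u, v} *\<^sub>R (p v - p u)) = (\<Sum>u\<in>N. \<omega> {u, v} *\<^sub>R (p v - p u))"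
    using assms by (intro sum.mono_neutral_right) auto
  moreover have "(\<Sum>l\<in>L. if b l = v then \<mu> l *\<^sub>R q l else 0) = (\<Sum>l | l \<in> L \<and> b l = v. \<mu> l *\<^sub>R q l)"
    using assms(4) by (simp add: sum.inter_filter)
  ultimately show ?thesis by (simp add: stress_force_def)
qed

section \<open>Putting a vertex back\<close>

lemma stress_free_zero_extension:
  assumes fin: "finite V" "finite L" and v: "v \<in> V" and E: "edges_on V E"
    and N: "N = {u. {u, v} \<in> E}" and K: "K = {l. l \<in> L \<and> b l = v}"
    and sf: "stress_free (V - {v}) {e \<in> E. v \<notin> e} {l \<in> L. b l \<noteq> v} b p q"
    and pq': "\<And>u. u \<noteq> v \<Longrightarrow> p' u = p u" "\<And>l. l \<in> L \<Longrightarrow> b l \<noteq> v \<Longrightarrow> q' l = q l"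
    and local: "\<And>\<omega> \<mu>. (\<Sum>u\<in>N. \<omega> u *\<^sub>R (p' v - p u)) + (\<Sum>l\<in>K. \<mu> l *\<^sub>R q' l) = 0 \<Longrightarrow>
      (\<forall>u\<in>N. \<omega> u = 0) \<and> (\<forall>l\<in>K. \<mu> l = 0)"
  shows "stress_free V E L b p' q'"
proof (rule stress_freeI)
  fix \<omega> \<mu>
  assume supp: "\<And>e. e \<notin> E \<Longrightarrow> \<omega> e = 0"
    and eq: "\<And>x. x \<in> V \<Longrightarrow> stress_force V L b p' q' \<omega> \<mu> x = 0"
  have N': "u \<in> V" "u \<noteq> v" if "u \<in> N" for u using that edges_on_pair[OF E] N by auto
  have "(\<Sum>u\<in>N. \<omega> {u, v} *\<^sub>R (p' v - p' u)) + (\<Sum>l | l \<in> L \<and> b l = v. \<mu> l *\<^sub>R q' l) = 0"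
    using stress_force_neighbours[OF fin(1) _ _ fin(2), of N v E \<omega> b p' q' \<mu>] supp eq[OF v] N N'
    by auto
  moreover have "(\<Sum>u\<in>N. \<omega> {u, v} *\<^sub>R (p' v - p' u)) = (\<Sum>u\<in>N. \<omega> {u, v} *\<^sub>R (p' v - p u))"
    using N' pq' by (intro sum.cong) auto
  ultimately have "(\<Sum>u\<in>N. \<omega> {u, v} *\<^sub>R (p' v - p u)) + (\<Sum>l\<in>K. \<mu> l *\<^sub>R q' l) = 0"
    by (simp add: K)
  from local[OF this] have loc: "\<forall>u\<in>N. \<omega> {u, v} = 0" "\<forall>l\<in>L. b l = v \<longrightarrow> \<mu> l = 0"
    by (auto simp: K)
  \<comment> \<open>Equilibrium at \<open>v\<close> has killed all coefficients at \<open>v\<close>,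
    so what remains is a stress of the smaller framework.\<close>
  have \<omega>v: "\<omega> {u, v} = 0" for u using loc(1) supp[of "{u, v}"] N by blast
  have force: "stress_force (V - {v}) {l \<in> L. b l \<noteq> v} b p q \<omega> \<mu> x = 0" if x: "x \<in> V - {v}" for x
  proof -
    have "(\<Sum>l\<in>{l \<in> L. b l \<noteq> v}. if b l = x then \<mu> l *\<^sub>R q l else 0) =
        (\<Sum>l\<in>L. if b l = x then \<mu> l *\<^sub>R q' l else 0)"
      using fin(2) x pq' by (intro sum.mono_neutral_cong_left) auto
    moreover have "(\<Sum>u\<in>V - {v}. \<omega> {u, x} *\<^sub>R (p x - p u)) = (\<Sum>u\<in>V - {v}. \<omega> {u, x} *\<^sub>R (p' x - p' u))"
      using x pq' by (intro sum.cong) auto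
    ultimately show ?thesis
      using stress_force_remove[OF fin(1) v, of L b p' q' \<omega> \<mu> x] eq[of x] x \<omega>v[of x]
      by (simp add: stress_force_def insert_commute)
  qed
  have supp': "\<omega> e = 0" if "e \<notin> {e \<in> E. v \<notin> e}" for e
    using that supp \<omega>v edges_on_cases[OF E, of e v] by blast
  have "\<omega> e = 0" for e
    using stress_freeD(1)[OF sf supp' force, of e] supp'[of e] by blast
  moreover have "\<mu> l = 0" if "l \<in> L" for l
    using stress_freeD(2)[OF sf supp' force, of l] that loc(2) by blast
  ultimately show "(\<forall>e\<in>E. \<omega> e = 0) \<and> (\<forall>l\<in>L. \<mu> l = 0)" by blast
qed

text \<open>The new vertex is placed at the midpoint of the removed edge \<open>{x, y}\<close>; equilibrium there
  forces equal coefficients on its edges to \<open>x\<close> and \<open>y\<close>, which together act like the removed edge.\<close>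

lemma stress_free_edge_split:
  assumes fin: "finite V" "finite L" and v: "v \<in> V" and E: "edges_on V E"
    and N: "{u. {u, v} \<in> E} = {x, y, z}" "x \<noteq> y" "x \<noteq> z" "y \<noteq> z" and xy: "{x, y} \<notin> E"
    and L: "\<And>l. l \<in> L \<Longrightarrow> b l \<noteq> v"
    and sf: "stress_free (V - {v}) (insert {x, y} {e \<in> E. v \<notin> e}) L b p q"
    and noncoll: "cross2 (p z - p x) (p x - p y) \<noteq> 0"
  shows "stress_free V E L b (p(v := (1/2) *\<^sub>R (p x + p y))) q"
proof (rule stress_freeI)
  define m where "m = (1/2) *\<^sub>R (p x + p y)"
  fix \<omega> \<mu>
  let ?p = "p(v := (1/2) *\<^sub>R (p x + p y))"
  assume supp: "\<And>e. e \<notin> E \<Longrightarrow> \<omega> e = 0"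
    and eq: "\<And>x. x \<in> V \<Longrightarrow> stress_force V L b ?p q \<omega> \<mu> x = 0"
  have xyz: "x \<in> V" "y \<in> V" "z \<in> V" "x \<noteq> v" "y \<noteq> v" "z \<noteq> v"
    using N(1) edges_on_pair[OF E, of _ v] by auto
  have noloop: "{l. l \<in> L \<and> b l = v} = {}" using L by auto
  have "(\<Sum>u\<in>{x, y, z}. \<omega> {u, v} *\<^sub>R (?p v - ?p u)) = 0"
    using stress_force_neighbours[OF fin(1) _ _ fin(2), of "{x, y, z}" v E \<omega> b ?p q \<mu>] supp eq[OF v] N(1) xyz
    unfolding noloop by auto
  then have "\<omega> {x, v} *\<^sub>R (m - p x) + \<omega> {y, v} *\<^sub>R (m - p y) + \<omega> {z, v} *\<^sub>R (m - p z) = 0"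
    using N xyz by (simp add: m_def add.assoc)
  moreover have "m - p x = (- 1/2) *\<^sub>R (p x - p y)" "m - p y = (1/2) *\<^sub>R (p x - p y)"
    by (simp_all add: m_def vec_eq_iff algebra_simps)
  ultimately have "((\<omega> {y, v} - \<omega> {x, v}) / 2) *\<^sub>R (p x - p y) + \<omega> {z, v} *\<^sub>R (m - p z) = 0"
    by (simp add: algebra_simps diff_divide_distrib)
  moreover have "cross2 (p x - p y) (m - p z) = cross2 (p z - p x) (p x - p y)"
    by (simp add: m_def cross2_def field_simps)
  \<comment> \<open>Since \<open>z\<close> is off the line through \<open>x\<close> and
    \<open>y\<close>, the direction of that line and the direction from \<open>z\<close> to the
    midpoint are independent.\<close>
  ultimately have eqs: "\<omega> {y, v} = \<omega> {x, v}" "\<omega> {z, v} = 0"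
    using cross2_independent[of "(\<omega> {y, v} - \<omega> {x, v}) / 2" "p x - p y" "\<omega> {z, v}" "m - p z"] noncoll
    by auto
  define s where "s = \<omega> {x, v}"
  \<comment> \<open>The restored edge carries \<open>s / 2\<close> because \<open>p x - p y\<close>
    is twice \<open>p x - m\<close>. This is the stress of the smaller framework induced by
    \<open>\<omega>\<close>.\<close>
  define \<omega>' where "\<omega>' e = (if v \<in> e then 0 else if e = {x, y} then s / 2 else \<omega> e)" for e
  have \<omega>v: "\<omega> {v, t} = (if t = x \<or> t = y then s else 0)" for t
  proof (cases "{t, v} \<in> E")
    case True
    then have "t \<in> {x, y, z}" using N(1) by blast
    then show ?thesis using eqs N by (auto simp: s_def insert_commute)
  next
    case False
    then have "t \<notin> {x, y, z}" using N(1) by blast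
    then show ?thesis using supp[OF False] by (simp add: insert_commute)
  qed
  have force: "stress_force (V - {v}) L b p q \<omega>' \<mu> t = 0" if t: "t \<in> V - {v}" for t
  proof -
    have "(\<Sum>u\<in>V - {v}. \<omega>' {u, t} *\<^sub>R (p t - p u)) = (\<Sum>u\<in>V - {v}. \<omega> {u, t} *\<^sub>R (p t - p u) +
        (if {u, t} = {x, y} then (s / 2) *\<^sub>R (p t - p u) else 0))"
      using t xyz supp[OF xy] by (intro sum.cong) (auto simp: \<omega>'_def)
    also have "\<dots> = (\<Sum>u\<in>V - {v}. \<omega> {u, t} *\<^sub>R (p t - p u)) +
        (\<Sum>u\<in>V - {v}. if {u, t} = {x, y} then (s / 2) *\<^sub>R (p t - p u) else 0)"
      by (rule sum.distrib)
    also have "(\<Sum>u\<in>V - {v}. if {u, t} = {x, y} then (s / 2) *\<^sub>R (p t - p u) else 0) =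
        \<omega> {v, t} *\<^sub>R (p t - m)"
    proof -
      have half: "(s / 2) *\<^sub>R (p x - p y) = s *\<^sub>R (p x - m)" "(s / 2) *\<^sub>R (p y - p x) = s *\<^sub>R (p y - m)"
        by (simp_all add: m_def vec_eq_iff algebra_simps)
      have pair: "{u, t} = {x, y} \<longleftrightarrow> t = x \<and> u = y \<or> t = y \<and> u = x" for u
        by (auto simp: doubleton_eq_iff)
      consider "t = x" | "t = y" | "t \<noteq> x" "t \<noteq> y" by blast
      then show ?thesis
        unfolding pair \<omega>v using fin(1) xyz N(2) half by cases simp_all
    qed
    finally have *: "(\<Sum>u\<in>V - {v}. \<omega>' {u, t} *\<^sub>R (p t - p u)) =
        (\<Sum>u\<in>V - {v}. \<omega> {u, t} *\<^sub>R (p t - p u)) + \<omega> {v, t} *\<^sub>R (p t - m)" .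
    have **: "(\<Sum>u\<in>V - {v}. \<omega> {u, t} *\<^sub>R (p t - p u)) = (\<Sum>u\<in>V - {v}. \<omega> {u, t} *\<^sub>R (?p t - ?p u))"
      "p t - m = ?p t - ?p v"
      using t by (auto simp: m_def intro!: sum.cong)
    have "stress_force V L b ?p q \<omega> \<mu> t = 0" using eq t by blast
    then show ?thesis
      unfolding stress_force_remove[OF fin(1) v] unfolding stress_force_def * ** by (simp only: add_ac)
  qed
  have supp': "\<omega>' e = 0" if "e \<notin> insert {x, y} {e \<in> E. v \<notin> e}" for e
    using that supp by (auto simp: \<omega>'_def)
  have \<omega>'0: "\<omega>' e = 0" for e
    using stress_freeD(1)[OF sf supp' force, of e] supp'[of e] by blast
  have "s = 0" using \<omega>'0[of "{x, y}"] xyz by (simp add: \<omega>'_def)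
  have "\<omega> e = 0" if e: "e \<in> E" for e
  proof (cases "v \<in> e")
    case True
    then obtain u where "e = {u, v}" using edges_on_cases[OF E e] by blast
    then show ?thesis using \<omega>v[of u] \<open>s = 0\<close> by (simp add: insert_commute)
  next
    case False
    then show ?thesis using \<omega>'0[of e] e xy by (auto simp: \<omega>'_def split: if_splits)
  qed
  moreover have "\<mu> l = 0" if "l \<in> L" for l
    using stress_freeD(2)[OF sf supp' force, of l] that by blast
  ultimately show "(\<forall>e\<in>E. \<omega> e = 0) \<and> (\<forall>l\<in>L. \<mu> l = 0)" by blast
qed

text \<open>The new vertex is placed at \<open>p u + q l\<close>, so that the edge to \<open>u\<close> is parallel to the loop
  and transfers the force of the loop to \<open>u\<close>.\<close>

lemma stress_free_loop_split:
  assumes fin: "finite V" "finite L" and v: "v \<in> V" and E: "edges_on V E"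
    and N: "{t. {t, v} \<in> E} = {u, w}" "u \<noteq> w"
    and l: "l \<in> L" "\<And>k. k \<in> L \<Longrightarrow> b k = v \<longleftrightarrow> k = l"
    and sf: "stress_free (V - {v}) {e \<in> E. v \<notin> e} L (b(l := u)) p q"
    and noncoll: "cross2 (p w - p u) (q l) \<noteq> 0"
  shows "stress_free V E L b (p(v := p u + q l)) q"
proof (rule stress_freeI)
  fix \<omega> \<mu>
  let ?p = "p(v := p u + q l)"
  assume supp: "\<And>e. e \<notin> E \<Longrightarrow> \<omega> e = 0"
    and eq: "\<And>x. x \<in> V \<Longrightarrow> stress_force V L b ?p q \<omega> \<mu> x = 0"
  have uw: "u \<in> V" "w \<in> V" "u \<noteq> v" "w \<noteq> v"
    using N(1) edges_on_pair[OF E, of _ v] by auto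
  have loop: "{k. k \<in> L \<and> b k = v} = {l}" using l by auto
  have "(\<Sum>t\<in>{u, w}. \<omega> {t, v} *\<^sub>R (?p v - ?p t)) + \<mu> l *\<^sub>R q l = 0"
    using stress_force_neighbours[OF fin(1) _ _ fin(2), of "{u, w}" v E \<omega> b ?p q \<mu>] supp eq[OF v] N(1) uw
    unfolding loop by auto
  then have "(\<omega> {u, v} + \<mu> l) *\<^sub>R q l + \<omega> {w, v} *\<^sub>R (p u + q l - p w) = 0"
    using N uw by (simp add: algebra_simps)
  \<comment> \<open>The edge to \<open>u\<close> and the loop share the direction
    \<open>q l\<close>, so two independent directions act at \<open>v\<close>: \<open>q l\<close>
    and that of the edge to \<open>w\<close>.\<close>
  moreover have "cross2 (q l) (p u + q l - p w) = cross2 (p w - p u) (q l)"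
    by (simp add: cross2_def algebra_simps)
  ultimately have eqs: "\<mu> l = - \<omega> {u, v}" "\<omega> {w, v} = 0"
    using cross2_independent[of "\<omega> {u, v} + \<mu> l" "q l" "\<omega> {w, v}" "p u + q l - p w"] noncoll
    by auto
  define \<omega>' where "\<omega>' e = (if v \<in> e then 0 else \<omega> e)" for e
  have \<omega>v: "\<omega> {v, t} = (if t = u then - \<mu> l else 0)" for t
  proof (cases "{t, v} \<in> E")
    case True
    then have "t \<in> {u, w}" using N(1) by blast
    then show ?thesis using eqs N by (auto simp: insert_commute)
  next
    case False
    then have "t \<notin> {u, w}" using N(1) by blast
    then show ?thesis using supp[OF False] by (simp add: insert_commute)
  qed
  have force: "stress_force (V - {v}) L (b(l := u)) p q \<omega>' \<mu> t = 0" if t: "t \<in> V - {v}" for t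
  proof -
    have sums: "(\<Sum>s\<in>V - {v}. \<omega>' {s, t} *\<^sub>R (p t - p s)) = (\<Sum>s\<in>V - {v}. \<omega> {s, t} *\<^sub>R (?p t - ?p s))"
      using t by (intro sum.cong) (auto simp: \<omega>'_def)
    have "(\<Sum>k\<in>L. if (b(l := u)) k = t then \<mu> k *\<^sub>R q k else 0) =
        (\<Sum>k\<in>L. (if b k = t then \<mu> k *\<^sub>R q k else 0) + (if k = l then (if t = u then \<mu> l *\<^sub>R q l else 0) else 0))"
      using t l by (intro sum.cong) auto
    also have "\<dots> = (\<Sum>k\<in>L. if b k = t then \<mu> k *\<^sub>R q k else 0) + (if t = u then \<mu> l *\<^sub>R q l else 0)"
      using fin(2) l(1) by (simp add: sum.distrib)
    \<comment> \<open>At \<open>u\<close> the edge to \<open>v\<close> has vector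
      \<open>- q l\<close> and coefficient \<open>- \<mu> l\<close>, so it exerts exactly the force
      of the loop moved to \<open>u\<close>.\<close>
    also have "(if t = u then \<mu> l *\<^sub>R q l else 0) = \<omega> {v, t} *\<^sub>R (?p t - ?p v)"
      using uw by (simp add: \<omega>v)
    finally have loops: "(\<Sum>k\<in>L. if (b(l := u)) k = t then \<mu> k *\<^sub>R q k else 0) =
      (\<Sum>k\<in>L. if b k = t then \<mu> k *\<^sub>R q k else 0) + \<omega> {v, t} *\<^sub>R (?p t - ?p v)" .
    have "stress_force V L b ?p q \<omega> \<mu> t = 0" using eq t by blast
    then show ?thesis
      unfolding stress_force_remove[OF fin(1) v] unfolding stress_force_def sums loops by (simp only: add_ac)
  qed
  have supp': "\<omega>' e = 0" if "e \<notin> {e \<in> E. v \<notin> e}" for e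
    using that supp by (auto simp: \<omega>'_def)
  have \<omega>'0: "\<omega>' e = 0" for e
    using stress_freeD(1)[OF sf supp' force, of e] supp'[of e] by blast
  have \<mu>0: "\<mu> k = 0" if "k \<in> L" for k
    using stress_freeD(2)[OF sf supp' force, of k] that by blast
  have "\<omega> e = 0" if e: "e \<in> E" for e
  proof (cases "v \<in> e")
    case True
    then obtain t where "e = {t, v}" using edges_on_cases[OF E e] by blast
    then show ?thesis using \<omega>v[of t] \<mu>0[OF l(1)] by (simp add: insert_commute)
  next
    case False
    then show ?thesis using \<omega>'0[of e] by (simp add: \<omega>'_def)
  qed
  then show "(\<forall>e\<in>E. \<omega> e = 0) \<and> (\<forall>l\<in>L. \<mu> l = 0)" using \<mu>0 by blast
qed

section \<open>Sparse looped graphs\<close>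

definition edge_count :: "'v set set \<Rightarrow> 'v set \<Rightarrow> nat" where
  "edge_count E X = card {e \<in> E. e \<subseteq> X}"

definition loop_count :: "'l set \<Rightarrow> ('l \<Rightarrow> 'v) \<Rightarrow> 'v set \<Rightarrow> nat" where
  "loop_count L b X = card {l \<in> L. b l \<in> X}"

text \<open>The bounds reflect the \<open>2 * card X\<close> columns of \<open>X\<close> and, for
  edges alone, the three-dimensional space of infinitesimal isometries. The second bound would fail
  for sets with fewer than two vertices, and adding 3 on the left avoids truncated
  subtraction.\<close>

locale sparse_graph =
  fixes V :: "'v set" and E :: "'v set set" and L :: "'l set" and b :: "'l \<Rightarrow> 'v"
  assumes finite_V: "finite V" and finite_L: "finite L" and edges: "edges_on V E"
    and base_in: "l \<in> L \<Longrightarrow> b l \<in> V"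
    and count_le: "X \<subseteq> V \<Longrightarrow> edge_count E X + loop_count L b X \<le> 2 * card X"
    and edge_count_le: "X \<subseteq> V \<Longrightarrow> card X \<ge> 2 \<Longrightarrow> edge_count E X + 3 \<le> 2 * card X"
begin

section \<open>Tight sets and uncrossing\<close>

lemma finite_E: "finite E"
  using edges_on_finite[OF finite_V edges] .

lemma finite_sub: "X \<subseteq> V \<Longrightarrow> finite X"
  using finite_V finite_subset by blast

text \<open>The pinned sets block the insertion of new edges and loops inside them; the rigid sets
  defined next block new edges only, since loops do not enter their count.\<close>

definition pinned :: "'v set \<Rightarrow> bool" where
  "pinned X \<longleftrightarrow> X \<subseteq> V \<and> edge_count E X + loop_count L b X = 2 * card X"

definition rigid :: "'v set \<Rightarrow> bool" where
  "rigid X \<longleftrightarrow> X \<subseteq> V \<and> card X \<ge> 2 \<and> edge_count E X + 3 = 2 * card X"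

text \<open>Edges joining \<open>X - Y\<close> to \<open>Y - X\<close> are counted for the union
  only, whence an inequality. A loop has a single base vertex, so loop counts are modular.\<close>

lemma edge_count_supermodular:
  "edge_count E X + edge_count E Y \<le> edge_count E (X \<union> Y) + edge_count E (X \<inter> Y)"
proof -
  let ?A = "{e \<in> E. e \<subseteq> X}" and ?B = "{e \<in> E. e \<subseteq> Y}"
  have "card ?A + card ?B = card (?A \<union> ?B) + card (?A \<inter> ?B)"
    using finite_E by (intro card_Un_Int) auto
  moreover have "card (?A \<union> ?B) \<le> edge_count E (X \<union> Y)"
    unfolding edge_count_def using finite_E by (intro card_mono) auto
  moreover have "?A \<inter> ?B = {e \<in> E. e \<subseteq> X \<inter> Y}" by auto
  ultimately show ?thesis by (simp add: edge_count_def)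
qed

lemma loop_count_modular:
  "loop_count L b X + loop_count L b Y = loop_count L b (X \<union> Y) + loop_count L b (X \<inter> Y)"
proof -
  let ?A = "{l \<in> L. b l \<in> X}" and ?B = "{l \<in> L. b l \<in> Y}"
  have "card ?A + card ?B = card (?A \<union> ?B) + card (?A \<inter> ?B)"
    using finite_L by (intro card_Un_Int) auto
  moreover have "?A \<inter> ?B = {l \<in> L. b l \<in> X \<inter> Y}" "?A \<union> ?B = {l \<in> L. b l \<in> X \<union> Y}" by auto
  ultimately show ?thesis by (simp add: loop_count_def)
qed

lemma loop_count_mono: "X \<subseteq> Y \<Longrightarrow> loop_count L b X \<le> loop_count L b Y"
  unfolding loop_count_def using finite_L by (intro card_mono) auto

lemma card_Un_Int_sub: "X \<subseteq> V \<Longrightarrow> Y \<subseteq> V \<Longrightarrow> card X + card Y = card (X \<union> Y) + card (X \<inter> Y)"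
  using finite_sub by (intro card_Un_Int) auto

lemma pinned_empty: "pinned {}"
proof -
  have "{e \<in> E. e \<subseteq> {}} = {}" using edges by (auto simp: edges_on_def)
  then show ?thesis by (simp add: pinned_def edge_count_def loop_count_def)
qed

text \<open>The counts are supermodular while \<open>2 * card X\<close> is modular, so equality for
  \<open>X\<close> and \<open>Y\<close> forces equality for the union and the intersection.\<close>

lemma pinned_Un:
  assumes "pinned X" "pinned Y"
  shows "pinned (X \<union> Y)"
proof -
  have XY: "X \<subseteq> V" "Y \<subseteq> V" "X \<union> Y \<subseteq> V" "X \<inter> Y \<subseteq> V" using assms by (auto simp: pinned_def)
  show ?thesis
    using assms edge_count_supermodular[of X Y] loop_count_modular[of X Y] card_Un_Int_sub[OF XY(1,2)]
      count_le[OF XY(3)] count_le[OF XY(4)] XY(3)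
    unfolding pinned_def by linarith
qed

text \<open>The same uncrossing; two common vertices are required for the edge bound to apply to the
  intersection.\<close>

lemma rigid_Un:
  assumes "rigid X" "rigid Y" "card (X \<inter> Y) \<ge> 2"
  shows "rigid (X \<union> Y)"
proof -
  have XY: "X \<subseteq> V" "Y \<subseteq> V" "X \<union> Y \<subseteq> V" "X \<inter> Y \<subseteq> V"
    using assms by (auto simp: rigid_def)
  have "card X \<le> card (X \<union> Y)" using finite_sub[OF XY(3)] by (intro card_mono) auto
  then have "card (X \<union> Y) \<ge> 2" using assms(1) by (simp add: rigid_def)
  then show ?thesis
    using assms edge_count_supermodular[of X Y] card_Un_Int_sub[OF XY(1,2)]
      edge_count_le[OF XY(3)] edge_count_le[OF XY(4)] XY(3)
    unfolding rigid_def by linarith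
qed

text \<open>Here the full bound is used for the union and the edge bound for the intersection. The
  defect 3 of \<open>Y\<close> cancels against the defect 3 of the intersection, which leaves the
  union with no defect.\<close>

lemma pinned_rigid_Un:
  assumes "pinned X" "rigid Y" "card (X \<inter> Y) \<ge> 2"
  shows "pinned (X \<union> Y)"
proof -
  have XY: "X \<subseteq> V" "Y \<subseteq> V" "X \<union> Y \<subseteq> V" "X \<inter> Y \<subseteq> V"
    using assms by (auto simp: rigid_def pinned_def)
  have "loop_count L b X \<le> loop_count L b (X \<union> Y)" by (rule loop_count_mono) simp
  then show ?thesis
    using assms edge_count_supermodular[of X Y] card_Un_Int_sub[OF XY(1,2)]
      count_le[OF XY(3)] edge_count_le[OF XY(4)] XY(3)
    unfolding rigid_def pinned_def by linarith
qed

lemma disjoint_edges: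
  assumes "card (X \<inter> Y) \<le> 1" "X \<subseteq> V"
  shows "{e \<in> E. e \<subseteq> X} \<inter> {e \<in> E. e \<subseteq> Y} = {}"
proof (rule ccontr)
  assume "\<not> ?thesis"
  then obtain e where e: "e \<in> E" "e \<subseteq> X \<inter> Y" by auto
  then have "card e \<le> card (X \<inter> Y)" using finite_sub[OF assms(2)] by (intro card_mono) auto
  then show False using e(1) edges assms(1) by (auto simp: edges_on_def)
qed

text \<open>Three sets meeting pairwise in the corners of a triangle share no edge, and their sizes
  exceed that of the union by 3. For three rigid sets the defects then add up to
  \<open>9 - 6 = 3\<close>, so the union is rigid; if one of them is pinned instead, the defect is
  \<open>6 - 6 = 0\<close>.\<close>

lemma edge_count_triangle:
  assumes sub: "X \<subseteq> V" "Y \<subseteq> V" "Z \<subseteq> V"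
    and thin: "card (X \<inter> Y) \<le> 1" "card (Y \<inter> Z) \<le> 1" "card (X \<inter> Z) \<le> 1"
    and xyz: "x \<noteq> y" "x \<in> X" "y \<in> X" "y \<in> Y" "z \<in> Y" "x \<in> Z" "z \<in> Z" "y \<noteq> z" "x \<noteq> z"
  shows "edge_count E X + edge_count E Y + edge_count E Z \<le> edge_count E (X \<union> Y \<union> Z)"
    and "card X + card Y + card Z = card (X \<union> Y \<union> Z) + 3"
proof -
  let ?F = "\<lambda>X. {e \<in> E. e \<subseteq> X}"
  have "card (?F X \<union> ?F Y \<union> ?F Z) = card (?F X) + card (?F Y) + card (?F Z)"
    using disjoint_edges[OF thin(1) sub(1)] disjoint_edges[OF thin(2) sub(2)]
      disjoint_edges[OF thin(3) sub(1)] finite_E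
    by (subst card_Un_disjoint; (subst card_Un_disjoint)?) auto
  moreover have "card (?F X \<union> ?F Y \<union> ?F Z) \<le> card (?F (X \<union> Y \<union> Z))"
    using finite_E by (intro card_mono) auto
  ultimately show "edge_count E X + edge_count E Y + edge_count E Z \<le> edge_count E (X \<union> Y \<union> Z)"
    by (simp add: edge_count_def)
  have single: "A = {a}" if "card A \<le> 1" "a \<in> A" "A \<subseteq> V" for A a
    using that card_le_Suc0_iff_eq[OF finite_sub[OF that(3)]] by auto
  have XY: "X \<inter> Y = {y}" and YZ: "Y \<inter> Z = {z}" and XZ: "X \<inter> Z = {x}"
    by (rule single[OF thin(1)] single[OF thin(2)] single[OF thin(3)]; use xyz sub in blast)+
  have "(X \<union> Y) \<inter> Z = {x, z}" using YZ XZ by auto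
  then have "card ((X \<union> Y) \<inter> Z) = 2" "card (X \<inter> Y) = 1" using xyz XY by auto
  then show "card X + card Y + card Z = card (X \<union> Y \<union> Z) + 3"
    using card_Un_Int_sub[of X Y] card_Un_Int_sub[of "X \<union> Y" Z] sub by auto
qed

section \<open>Vertices of low degree and their removal\<close>

definition neighbours :: "'v \<Rightarrow> 'v set" where
  "neighbours v = {u. {u, v} \<in> E}"

lemma neighbours_sub: "neighbours v \<subseteq> V - {v}"
  using edges_on_pair[OF edges] by (auto simp: neighbours_def)

lemma finite_neighbours: "finite (neighbours v)"
  using neighbours_sub finite_sub by (meson Diff_subset subset_trans)

lemma inj_on_pair: "inj_on (\<lambda>u. {u, v}) A"
  by (auto simp: inj_on_def doubleton_eq_iff)

lemma card_neighbours: "card (neighbours v) = card {e \<in> E. v \<in> e}"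
proof -
  have "{e \<in> E. v \<in> e} = (\<lambda>u. {u, v}) ` neighbours v"
    by (auto simp: neighbours_def elim: edges_on_cases[OF edges])
  then show ?thesis by (simp add: card_image[OF inj_on_pair])
qed

lemma edge_count_insert:
  assumes "v \<notin> X" "neighbours v \<subseteq> X"
  shows "edge_count E X + card (neighbours v) \<le> edge_count E (insert v X)"
proof -
  let ?A = "{e \<in> E. e \<subseteq> X}" and ?B = "(\<lambda>u. {u, v}) ` neighbours v"
  have "card (?A \<union> ?B) = card ?A + card ?B"
    using finite_E finite_neighbours assms(1) by (intro card_Un_disjoint) auto
  moreover have "?A \<union> ?B \<subseteq> {e \<in> E. e \<subseteq> insert v X}"
    using assms(2) by (auto simp: neighbours_def)
  then have "card (?A \<union> ?B) \<le> edge_count E (insert v X)"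
    unfolding edge_count_def using finite_E by (intro card_mono) auto
  moreover have "card ?B = card (neighbours v)" by (rule card_image[OF inj_on_pair])
  ultimately show ?thesis by (simp add: edge_count_def)
qed

lemma loop_count_insert:
  assumes "v \<notin> X"
  shows "loop_count L b (insert v X) = loop_count L b X + card {l \<in> L. b l = v}"
proof -
  have "{l \<in> L. b l \<in> insert v X} = {l \<in> L. b l \<in> X} \<union> {l \<in> L. b l = v}" by auto
  moreover have "card ({l \<in> L. b l \<in> X} \<union> {l \<in> L. b l = v}) =
      card {l \<in> L. b l \<in> X} + card {l \<in> L. b l = v}"
    using finite_L assms by (intro card_Un_disjoint) auto
  ultimately show ?thesis by (simp add: loop_count_def)
qed

text \<open>Adding \<open>v\<close> would bring at least three new edges and loops but raise the
  bound by only two.\<close>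

lemma not_pinned_neighbours:
  assumes "v \<in> V" "v \<notin> X" "neighbours v \<subseteq> X" "card (neighbours v) + card {l \<in> L. b l = v} \<ge> 3"
  shows "\<not> pinned X"
proof
  assume X: "pinned X"
  then have "insert v X \<subseteq> V" "finite X" using assms(1) finite_sub by (auto simp: pinned_def)
  then show False
    using X count_le[of "insert v X"] edge_count_insert[OF assms(2,3)] loop_count_insert[OF assms(2)] assms(2,4)
    unfolding pinned_def by simp
qed

lemma not_rigid_neighbours:
  assumes "v \<in> V" "v \<notin> X" "neighbours v \<subseteq> X" "card (neighbours v) \<ge> 3"
  shows "\<not> rigid X"
proof
  assume X: "rigid X"
  then have "insert v X \<subseteq> V" "finite X" using assms(1) finite_sub by (auto simp: rigid_def)
  then show False
    using X edge_count_le[of "insert v X"] edge_count_insert[OF assms(2,3)] assms(2,4)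
    unfolding rigid_def by simp
qed

text \<open>Provides the neighbour to which the loop at \<open>v\<close> can be moved. If each
  neighbour lay in a pinned set avoiding \<open>v\<close>, the union of the two sets would be pinned
  and contain all neighbours of \<open>v\<close>.\<close>

lemma exists_loop_reduction:
  assumes "v \<in> V" "neighbours v = {u, w}" "u \<noteq> w" "card {l \<in> L. b l = v} = 1"
  shows "\<exists>t\<in>{u, w}. \<forall>X. v \<notin> X \<longrightarrow> t \<in> X \<longrightarrow> \<not> pinned X"
proof (rule ccontr)
  assume "\<not> ?thesis"
  then obtain X Y where "v \<notin> X" "u \<in> X" "pinned X" "v \<notin> Y" "w \<in> Y" "pinned Y" by auto
  then have "pinned (X \<union> Y)" "v \<notin> X \<union> Y" "neighbours v \<subseteq> X \<union> Y"
    using pinned_Un assms(2) by auto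
  then show False using not_pinned_neighbours[OF assms(1), of "X \<union> Y"] assms(2-4) by simp
qed

text \<open>Provides the pair of neighbours to be joined when \<open>v\<close> is removed. If every
  pair lay in a tight set avoiding \<open>v\<close>, these three sets would combine into a tight set
  containing all three neighbours, which the degree of \<open>v\<close> forbids.\<close>

lemma exists_edge_reduction:
  assumes v: "v \<in> V" and N: "card (neighbours v) = 3"
  shows "\<exists>x y z. neighbours v = {x, y, z} \<and> x \<noteq> y \<and> x \<noteq> z \<and> y \<noteq> z \<and>
    (\<forall>X. v \<notin> X \<longrightarrow> x \<in> X \<longrightarrow> y \<in> X \<longrightarrow> \<not> rigid X \<and> \<not> pinned X)"
proof (rule ccontr)
  assume neg: "\<not> ?thesis"
  obtain x y z where xyz: "neighbours v = {x, y, z}" "x \<noteq> y" "x \<noteq> z" "y \<noteq> z"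
    using N by (auto simp: card_3_iff)
  have neg': "\<not> (neighbours v = {s, t, u} \<and> s \<noteq> t \<and> s \<noteq> u \<and> t \<noteq> u \<and>
      (\<forall>X. v \<notin> X \<longrightarrow> s \<in> X \<longrightarrow> t \<in> X \<longrightarrow> \<not> rigid X \<and> \<not> pinned X))" for s t u
    using neg by (simp only: not_ex simp_thms)
  have tight: "\<exists>X. v \<notin> X \<and> s \<in> X \<and> t \<in> X \<and> (rigid X \<or> pinned X)"
    if "neighbours v = {s, t, u}" "s \<noteq> t" "s \<noteq> u" "t \<noteq> u" for s t u
    using neg'[of s t u] that by (simp del: insert_iff)
  obtain X where X: "v \<notin> X" "x \<in> X" "y \<in> X" "rigid X \<or> pinned X"
    using tight[of x y z] xyz by blast
  obtain Y where Y: "v \<notin> Y" "y \<in> Y" "z \<in> Y" "rigid Y \<or> pinned Y"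
    using tight[of y z x] xyz(2-4) unfolding xyz(1) by auto
  obtain Z where Z: "v \<notin> Z" "x \<in> Z" "z \<in> Z" "rigid Z \<or> pinned Z"
    using tight[of x z y] xyz(2-4) unfolding xyz(1) by auto
  have no_tight: "\<not> rigid U" "\<not> pinned U" if "v \<notin> U" "x \<in> U" "y \<in> U" "z \<in> U" for U
    using not_rigid_neighbours[OF v, of U] not_pinned_neighbours[OF v, of U] that N xyz by auto
  \<comment> \<open>Two of the three sets already contain all three neighbours, so their union is
    not tight. Uncrossing therefore excludes two common vertices and also excludes two pinned
    sets.\<close>
  have thin: "card (A \<inter> B) \<le> 1 \<and> \<not> (pinned A \<and> pinned B)"
    if "rigid A \<or> pinned A" "rigid B \<or> pinned B" "v \<notin> A \<union> B" "x \<in> A \<union> B" "y \<in> A \<union> B" "z \<in> A \<union> B" for A B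
  proof
    show "\<not> (pinned A \<and> pinned B)" using pinned_Un no_tight(2)[OF that(3-6)] by blast
    show "card (A \<inter> B) \<le> 1"
    proof (rule ccontr)
      assume "\<not> ?thesis"
      then have "card (A \<inter> B) \<ge> 2" "card (B \<inter> A) \<ge> 2" by (simp_all add: Int_commute)
      then have "rigid (A \<union> B) \<or> pinned (A \<union> B)"
        using that(1,2) pinned_Un rigid_Un pinned_rigid_Un[of A B] pinned_rigid_Un[of B A]
        unfolding Un_commute[of B A] by blast
      then show False using no_tight[OF that(3-6)] by blast
    qed
  qed
  have t: "card (X \<inter> Y) \<le> 1" "card (Y \<inter> Z) \<le> 1" "card (X \<inter> Z) \<le> 1"
      "\<not> (pinned X \<and> pinned Y)" "\<not> (pinned Y \<and> pinned Z)" "\<not> (pinned X \<and> pinned Z)"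
    using thin[of X Y] thin[of Y Z] thin[of X Z] X Y Z by auto
  have sub: "X \<subseteq> V" "Y \<subseteq> V" "Z \<subseteq> V" using X Y Z by (auto simp: rigid_def pinned_def)
  let ?U = "X \<union> Y \<union> Z"
  note tri = edge_count_triangle[OF sub t(1-3) xyz(2) X(2,3) Y(2,3) Z(2,3) xyz(4,3)]
  have U: "\<not> rigid ?U" "\<not> pinned ?U" using no_tight[of ?U] X Y Z by auto
  have Usub: "?U \<subseteq> V" using sub by auto
  have "card {x, y} \<le> card ?U" using X finite_sub[OF Usub] by (intro card_mono) auto
  then have U2: "card ?U \<ge> 2" using xyz by simp
  have lt: "edge_count E ?U + 3 < 2 * card ?U" "edge_count E ?U + loop_count L b ?U < 2 * card ?U"
    using U edge_count_le[OF Usub U2] count_le[OF Usub] Usub U2 by (auto simp: rigid_def pinned_def)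
  have lc: "loop_count L b X \<le> loop_count L b ?U" "loop_count L b Y \<le> loop_count L b ?U"
    "loop_count L b Z \<le> loop_count L b ?U" by (auto intro!: loop_count_mono)
  \<comment> \<open>At most one set is pinned. The triangle count makes the union pinned if one is,
    and rigid if none is.\<close>
  consider "pinned X" "rigid Y" "rigid Z" | "rigid X" "pinned Y" "rigid Z" | "rigid X" "rigid Y" "pinned Z"
    | "rigid X" "rigid Y" "rigid Z"
    using X(4) Y(4) Z(4) t(4-6) by blast
  then show False
  proof cases
    case 1
    then show ?thesis using tri lt(2) lc(1) by (simp add: rigid_def pinned_def)
  next
    case 2
    then show ?thesis using tri lt(2) lc(2) by (simp add: rigid_def pinned_def)
  next
    case 3
    then show ?thesis using tri lt(2) lc(3) by (simp add: rigid_def pinned_def)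
  next
    case 4
    then show ?thesis using tri lt(1) by (simp add: rigid_def)
  qed
qed

text \<open>Degree plus twice the number of loops sums to at most \<open>4 * card V\<close>. A
  vertex violating all three alternatives contributes at least 4, with equality only for degree 4
  and no loop. If all violated them, then \<open>card E = 2 * card V\<close>, against the edge
  bound.\<close>

lemma exists_low_degree_vertex:
  assumes "V \<noteq> {}"
  shows "\<exists>v\<in>V. card (neighbours v) + card {l \<in> L. b l = v} \<le> 2 \<or>
    (card (neighbours v) = 3 \<and> card {l \<in> L. b l = v} = 0) \<or>
    (card (neighbours v) = 2 \<and> card {l \<in> L. b l = v} = 1)"
proof (rule ccontr)
  assume neg: "\<not> ?thesis"
  let ?d = "\<lambda>v. card (neighbours v)" and ?l = "\<lambda>v. card {l \<in> L. b l = v}"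
  have d_sum: "(\<Sum>v\<in>V. ?d v) = 2 * card E"
  proof -
    have "\<forall>e\<in>E. card {v \<in> V. v \<in> e} = 2"
    proof
      fix e assume "e \<in> E"
      then have "{v \<in> V. v \<in> e} = e" "card e = 2" using edges by (auto simp: edges_on_def)
      then show "card {v \<in> V. v \<in> e} = 2" by simp
    qed
    then show ?thesis unfolding card_neighbours using finite_V finite_E by (rule sum_multicount[rotated 2])
  qed
  have l_sum: "(\<Sum>v\<in>V. ?l v) = card L"
  proof -
    have "\<forall>l\<in>L. card {v \<in> V. b l = v} = 1"
    proof
      fix l assume "l \<in> L"
      then have "{v \<in> V. b l = v} = {b l}" using base_in by auto
      then show "card {v \<in> V. b l = v} = 1" by simp
    qed
    then have "(\<Sum>v\<in>V. ?l v) = 1 * card L" using finite_V finite_L by (rule sum_multicount[rotated 2])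
    then show ?thesis by simp
  qed
  have all: "{e \<in> E. e \<subseteq> V} = E" "{l \<in> L. b l \<in> V} = L" using edges base_in by (auto simp: edges_on_def)
  have "card E + card L \<le> 2 * card V"
    using count_le[of V] by (simp add: edge_count_def loop_count_def all)
  then have total: "(\<Sum>v\<in>V. ?d v + 2 * ?l v) \<le> (\<Sum>v\<in>V. 4)"
    by (simp add: sum.distrib sum_distrib_left[symmetric] d_sum l_sum)
  have ge: "?d v + 2 * ?l v \<ge> 4 \<and> (?d v = 4 \<or> ?d v + 2 * ?l v > 4)" if "v \<in> V" for v
  proof -
    have "\<not> (?d v + ?l v \<le> 2 \<or> (?d v = 3 \<and> ?l v = 0) \<or> (?d v = 2 \<and> ?l v = 1))"
      using neg that by blast
    then show ?thesis by arith
  qed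
  have d4: "?d v = 4" if "v \<in> V" for v
  proof (rule ccontr)
    assume "?d v \<noteq> 4"
    then have "4 < ?d v + 2 * ?l v" using ge[OF that] by blast
    then have "(\<Sum>v\<in>V. 4) < (\<Sum>v\<in>V. ?d v + 2 * ?l v)"
      using ge that finite_V by (intro sum_strict_mono_ex1) auto
    then show False using total by simp
  qed
  obtain v where v: "v \<in> V" using assms by blast
  have "card (neighbours v) \<le> card (V - {v})"
    using finite_V neighbours_sub by (intro card_mono) auto
  \<comment> \<open>Four neighbours guarantee the size that the edge bound asks for.\<close>
  then have "card V \<ge> 2" using d4[OF v] v finite_V by simp
  then have "card E + 3 \<le> 2 * card V" using edge_count_le[of V] by (simp add: edge_count_def all)
  moreover have "2 * card E = 4 * card V" using d_sum d4 by simp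
  ultimately show False by simp
qed

end

section \<open>Realising sparse graphs\<close>

text \<open>At most two vectors act at the new vertex, and its position and the directions of its
  loops are free, so they can be made independent. Only two neighbours without a loop constrain the
  given data: they have to be at different points.\<close>

lemma exists_local_extension:
  fixes p :: "'v \<Rightarrow> real^2" and q :: "'l \<Rightarrow> real^2"
  assumes "finite N" "finite K" "card N + card K \<le> 2" "inj_on p N"
  shows "\<exists>z q'. (\<forall>l. l \<notin> K \<longrightarrow> q' l = q l) \<and>
    (\<forall>\<omega> \<mu>. (\<Sum>u\<in>N. \<omega> u *\<^sub>R (z - p u)) + (\<Sum>l\<in>K. \<mu> l *\<^sub>R q' l) = 0 \<longrightarrow>
      (\<forall>u\<in>N. \<omega> u = 0) \<and> (\<forall>l\<in>K. \<mu> l = 0))"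
proof -
  define e1 e2 :: "real^2" where "e1 = axis 1 1" and "e2 = axis 2 1"
  have nz: "e1 \<noteq> 0" "e2 \<noteq> 0" and cr: "cross2 e1 e2 \<noteq> 0"
    by (auto simp: e1_def e2_def axis_def cross2_def vec_eq_iff)
  have "card N = 0 \<or> card N = 1 \<or> card N = 2" "card K = 0 \<or> card K = 1 \<or> card K = 2"
    using assms(3) by arith+
  then consider (00) "N = {}" "K = {}" | (01) k where "N = {}" "K = {k}"
    | (02) j k where "N = {}" "K = {j, k}" "j \<noteq> k"
    | (10) u where "N = {u}" "K = {}" | (11) u k where "N = {u}" "K = {k}"
    | (20) u w where "N = {u, w}" "K = {}" "u \<noteq> w"
    using assms(1-3) by (elim disjE) (auto simp: card_1_singleton_iff card_2_iff)
  then show ?thesis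
  proof cases
    case 00
    then show ?thesis by (intro exI[of _ 0] exI[of _ q]) simp
  next
    case (01 k)
    then show ?thesis using nz by (intro exI[of _ 0] exI[of _ "q(k := e1)"]) simp
  next
    case (02 j k)
    then show ?thesis using cross2_independent[OF _ cr]
      by (intro exI[of _ 0] exI[of _ "q(j := e1, k := e2)"]) auto
  next
    case (10 u)
    then show ?thesis using nz by (intro exI[of _ "p u + e1"] exI[of _ q]) simp
  next
    case (11 u k)
    then show ?thesis using cross2_independent[OF _ cr]
      by (intro exI[of _ "p u + e1"] exI[of _ "q(k := e2)"]) auto
  next
    case (20 u w)
    \<comment> \<open>With the new vertex at \<open>p u + perp d\<close> the two edge vectors are
      \<open>perp d\<close> and \<open>perp d - d\<close>.\<close>
    define d where "d = p w - p u"
    have "d \<noteq> 0" using 20 assms(4) by (auto simp: d_def)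
    then have "cross2 (perp d) (perp d - d) \<noteq> 0"
      using cross2_perp_nonzero by (simp add: cross2_simps)
    then have "\<omega> u = 0 \<and> \<omega> w = 0"
      if "\<omega> u *\<^sub>R (p u + perp d - p u) + \<omega> w *\<^sub>R (p u + perp d - p w) = 0" for \<omega>
      using cross2_independent[of "\<omega> u" "perp d" "\<omega> w" "perp d - d"] that
      by (simp add: d_def algebra_simps)
    then show ?thesis using 20
      by (intro exI[of _ "p u + perp d"] exI[of _ q]) (simp del: add_diff_cancel_left')
  qed
qed

context sparse_graph begin

lemma sparse_graph_delete_vertex:
  "sparse_graph (V - {v}) {e \<in> E. v \<notin> e} {l \<in> L. b l \<noteq> v} b"
proof
  show "finite (V - {v})" "finite {l \<in> L. b l \<noteq> v}" using finite_V finite_L by auto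
  show "edges_on (V - {v}) {e \<in> E. v \<notin> e}" using edges by (auto simp: edges_on_def)
  show "b l \<in> V - {v}" if "l \<in> {l \<in> L. b l \<noteq> v}" for l using that base_in by auto
  fix X assume X: "X \<subseteq> V - {v}"
  then have X': "X \<subseteq> V" by auto
  have "{e \<in> {e \<in> E. v \<notin> e}. e \<subseteq> X} = {e \<in> E. e \<subseteq> X}" using X by auto
  moreover have "{l \<in> {l \<in> L. b l \<noteq> v}. b l \<in> X} = {l \<in> L. b l \<in> X}" using X by auto
  ultimately have eq: "edge_count {e \<in> E. v \<notin> e} X = edge_count E X"
    "loop_count {l \<in> L. b l \<noteq> v} b X = loop_count L b X"
    by (simp_all add: edge_count_def loop_count_def)
  show "edge_count {e \<in> E. v \<notin> e} X + loop_count {l \<in> L. b l \<noteq> v} b X \<le> 2 * card X"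
    using count_le[OF X'] eq by simp
  show "edge_count {e \<in> E. v \<notin> e} X + 3 \<le> 2 * card X" if "card X \<ge> 2"
    using edge_count_le[OF X' that] eq by simp
qed

text \<open>The new edge raises, by at most one, only the counts of sets containing both its ends,
  so only tight sets among these can obstruct.\<close>

lemma sparse_graph_insert_edge:
  assumes xy: "x \<in> V" "y \<in> V" "x \<noteq> y"
    and free: "\<And>X. x \<in> X \<Longrightarrow> y \<in> X \<Longrightarrow> \<not> rigid X \<and> \<not> pinned X"
  shows "sparse_graph V (insert {x, y} E) L b"
proof
  show "finite V" "finite L" by (fact finite_V finite_L)+
  show "edges_on V (insert {x, y} E)" using edges xy by (auto simp: edges_on_def)
  show "b l \<in> V" if "l \<in> L" for l using that by (rule base_in)
  have le: "edge_count (insert {x, y} E) X \<le> edge_count E X + (if x \<in> X \<and> y \<in> X then 1 else 0)" for X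
  proof -
    have "{e \<in> insert {x, y} E. e \<subseteq> X} \<subseteq> (if x \<in> X \<and> y \<in> X then insert {x, y} {e \<in> E. e \<subseteq> X} else {e \<in> E. e \<subseteq> X})"
      by auto
    then have "edge_count (insert {x, y} E) X \<le>
        card (if x \<in> X \<and> y \<in> X then insert {x, y} {e \<in> E. e \<subseteq> X} else {e \<in> E. e \<subseteq> X})"
      unfolding edge_count_def using finite_E by (intro card_mono) auto
    also have "\<dots> \<le> edge_count E X + (if x \<in> X \<and> y \<in> X then 1 else 0)"
      using finite_E by (simp add: edge_count_def card_insert_if)
    finally show ?thesis .
  qed
  fix X assume X: "X \<subseteq> V"
  show "edge_count (insert {x, y} E) X + loop_count L b X \<le> 2 * card X"
    using le[of X] count_le[OF X] free[of X] X by (auto simp: pinned_def split: if_splits)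
  show "edge_count (insert {x, y} E) X + 3 \<le> 2 * card X" if "card X \<ge> 2"
    using le[of X] edge_count_le[OF X that] free[of X] X that by (auto simp: rigid_def split: if_splits)
qed

lemma sparse_graph_insert_loop:
  assumes u: "u \<in> V" and l: "l \<notin> L" and free: "\<And>X. u \<in> X \<Longrightarrow> \<not> pinned X"
  shows "sparse_graph V E (insert l L) (b(l := u))"
proof
  show "finite V" "finite (insert l L)" using finite_V finite_L by auto
  show "edges_on V E" by (rule edges)
  show "(b(l := u)) k \<in> V" if "k \<in> insert l L" for k using that base_in u by auto
  fix X assume X: "X \<subseteq> V"
  have eq: "{k \<in> insert l L. (b(l := u)) k \<in> X} =
      (if u \<in> X then insert l {k \<in> L. b k \<in> X} else {k \<in> L. b k \<in> X})"
    using l by auto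
  have "loop_count (insert l L) (b(l := u)) X = loop_count L b X + (if u \<in> X then 1 else 0)"
    unfolding loop_count_def eq using finite_L l by simp
  then show "edge_count E X + loop_count (insert l L) (b(l := u)) X \<le> 2 * card X"
    using count_le[OF X] free[of X] X by (auto simp: pinned_def)
  show "edge_count E X + 3 \<le> 2 * card X" if "card X \<ge> 2" using edge_count_le[OF X that] .
qed

end

text \<open>The reductions choose their edge or loop by means of tight sets of the whole graph
  avoiding \<open>v\<close>; this transfers the choice to the graph in which the insertion takes
  place.\<close>

lemma tight_delete_vertex:
  assumes "sparse_graph V E L b"
  shows "sparse_graph.pinned (V - {v}) {e \<in> E. v \<notin> e} {l \<in> L. b l \<noteq> v} b X \<Longrightarrow>
      v \<notin> X \<and> sparse_graph.pinned V E L b X"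
    and "sparse_graph.rigid (V - {v}) {e \<in> E. v \<notin> e} X \<Longrightarrow> v \<notin> X \<and> sparse_graph.rigid V E X"
proof -
  interpret sparse_graph V E L b by fact
  interpret D: sparse_graph "V - {v}" "{e \<in> E. v \<notin> e}" "{l \<in> L. b l \<noteq> v}" b
    by (rule sparse_graph_delete_vertex)
  have eq: "edge_count {e \<in> E. v \<notin> e} X = edge_count E X"
    "loop_count {l \<in> L. b l \<noteq> v} b X = loop_count L b X" if "v \<notin> X"
    using that by (auto simp: edge_count_def loop_count_def intro!: arg_cong[where f = card])
  show "v \<notin> X \<and> pinned X" if X: "D.pinned X"
  proof -
    have "v \<notin> X" using X unfolding D.pinned_def by auto
    with X eq show ?thesis unfolding D.pinned_def pinned_def by auto
  qed
  show "v \<notin> X \<and> rigid X" if X: "D.rigid X"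
  proof -
    have "v \<notin> X" using X unfolding D.rigid_def by auto
    with X eq show ?thesis unfolding D.rigid_def rigid_def by auto
  qed
qed

text \<open>A Henneberg-type induction: the three kinds of low-degree vertex are put back by a zero
  extension, an edge split and a loop split.\<close>

theorem sparse_graph_stress_free:
  assumes "sparse_graph V E L b"
  shows "\<exists>p q. stress_free V E L b p q"
  using assms
proof (induction "card V" arbitrary: V E L b)
  case 0
  interpret sparse_graph V E L b by fact
  have "V = {}" using 0 finite_V by simp
  then have "E = {}" "L = {}" using edges base_in by (auto simp: edges_on_def)
  then show ?case by (simp add: stress_free_def)
next
  case (Suc n)
  interpret sparse_graph V E L b by fact
  have "V \<noteq> {}" using Suc.hyps(2) by auto
  then obtain v where v: "v \<in> V" and
    low: "card (neighbours v) + card {l \<in> L. b l = v} \<le> 2 \<or>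
      (card (neighbours v) = 3 \<and> card {l \<in> L. b l = v} = 0) \<or>
      (card (neighbours v) = 2 \<and> card {l \<in> L. b l = v} = 1)"
    using exists_low_degree_vertex by blast
  have n: "n = card (V - {v})" using Suc.hyps(2) v finite_V by simp
  let ?V = "V - {v}" and ?E = "{e \<in> E. v \<notin> e}" and ?L = "{l \<in> L. b l \<noteq> v}"
  interpret D: sparse_graph ?V ?E ?L b by (rule sparse_graph_delete_vertex)
  note tight = tight_delete_vertex[OF Suc.prems, of v]
  consider (zero) "card (neighbours v) + card {l \<in> L. b l = v} \<le> 2"
    | (edge) "card (neighbours v) = 3" "card {l \<in> L. b l = v} = 0"
    | (loop) "card (neighbours v) = 2" "card {l \<in> L. b l = v} = 1"
    using low by meson
  then show ?case
  proof cases
    case zero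
    obtain p q where pq: "stress_free ?V ?E ?L b p q"
      using Suc.hyps(1)[OF n D.sparse_graph_axioms] by blast
    \<comment> \<open>Two neighbours must be separated first. The direction \<open>axis 1 1\<close>
      is an arbitrary nonzero one: off the line through \<open>p u\<close> in particular means
      different from \<open>p u\<close>.\<close>
    have "\<exists>p. stress_free ?V ?E ?L b p q \<and> inj_on p (neighbours v)"
    proof (cases "card (neighbours v) = 2")
      case True
      then obtain u w where uw: "neighbours v = {u, w}" "u \<noteq> w" by (auto simp: card_2_iff)
      obtain z where z: "stress_free ?V ?E ?L b (p(w := z)) q" "cross2 (z - p u) (axis 1 1) \<noteq> 0"
        using stress_free_perturb[OF D.finite_V D.finite_L D.edges pq, of "axis 1 1" w "p u"]
        by (auto simp: axis_eq_0_iff)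
      have "z \<noteq> p u" using z(2) by (auto simp: cross2_simps)
      then show ?thesis using z(1) uw by (intro exI[of _ "p(w := z)"]) auto
    next
      case False
      then have "card (neighbours v) \<le> 1" using zero by simp
      then have "inj_on p (neighbours v)"
        using card_le_Suc0_iff_eq[OF finite_neighbours] by (auto simp: inj_on_def)
      then show ?thesis using pq by blast
    qed
    then obtain p where p: "stress_free ?V ?E ?L b p q" "inj_on p (neighbours v)" by blast
    obtain z q' where z: "\<forall>l. l \<notin> {l \<in> L. b l = v} \<longrightarrow> q' l = q l"
        "\<forall>\<omega> \<mu>. (\<Sum>u\<in>neighbours v. \<omega> u *\<^sub>R (z - p u)) + (\<Sum>l\<in>{l \<in> L. b l = v}. \<mu> l *\<^sub>R q' l) = 0 \<longrightarrow>
          (\<forall>u\<in>neighbours v. \<omega> u = 0) \<and> (\<forall>l\<in>{l \<in> L. b l = v}. \<mu> l = 0)"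
      using exists_local_extension[OF finite_neighbours _ zero p(2), of q] finite_L by auto
    have "stress_free V E L b (p(v := z)) q'"
    proof (rule stress_free_zero_extension[OF finite_V finite_L v edges neighbours_def refl p(1)])
      fix \<omega> \<mu>
      assume a: "(\<Sum>u\<in>neighbours v. \<omega> u *\<^sub>R ((p(v := z)) v - p u)) + (\<Sum>l\<in>{l \<in> L. b l = v}. \<mu> l *\<^sub>R q' l) = 0"
      show "(\<forall>u\<in>neighbours v. \<omega> u = 0) \<and> (\<forall>l\<in>{l \<in> L. b l = v}. \<mu> l = 0)"
        by (rule z(2)[THEN spec, THEN spec, THEN mp]) (rule a[unfolded fun_upd_same])
    qed (use z(1) in auto)
    then show ?thesis by blast
  next
    case edge
    have "{l \<in> L. b l = v} = {}" using edge(2) finite_L by simp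
    then have L: "?L = L" "\<And>l. l \<in> L \<Longrightarrow> b l \<noteq> v" by auto
    obtain x y z where xyz: "neighbours v = {x, y, z}" "x \<noteq> y" "x \<noteq> z" "y \<noteq> z"
      and free: "\<forall>X. v \<notin> X \<longrightarrow> x \<in> X \<longrightarrow> y \<in> X \<longrightarrow> \<not> rigid X \<and> \<not> pinned X"
      using exists_edge_reduction[OF v edge(1)] by blast
    have V': "x \<in> ?V" "y \<in> ?V" "z \<in> ?V" using neighbours_sub[of v] xyz(1) by auto
    \<comment> \<open>An existing edge would make its pair of ends rigid, which the choice of the
      pair excludes.\<close>
    have xyE: "{x, y} \<notin> E"
    proof
      assume "{x, y} \<in> E"
      then have "{e \<in> E. e \<subseteq> {x, y}} \<supseteq> {{x, y}}" by auto
      then have "card {{x, y}} \<le> edge_count E {x, y}"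
        unfolding edge_count_def using finite_E by (intro card_mono) auto
      then have "rigid {x, y}" using V' xyz(2) edge_count_le[of "{x, y}"] by (simp add: rigid_def)
      moreover have "v \<notin> {x, y}" using V' by auto
      ultimately show False using free[THEN spec, of "{x, y}"] by blast
    qed
    have "sparse_graph ?V (insert {x, y} ?E) ?L b"
    proof (rule D.sparse_graph_insert_edge[OF V'(1,2) xyz(2)])
      fix X assume "x \<in> X" "y \<in> X"
      then show "\<not> D.rigid X \<and> \<not> D.pinned X"
        using tight[of X] free[THEN spec, of X] by argo
    qed
    then interpret D': sparse_graph ?V "insert {x, y} ?E" L b unfolding L(1) .
    obtain p q where pq: "stress_free ?V (insert {x, y} ?E) L b p q"
      using Suc.hyps(1)[OF n D'.sparse_graph_axioms] by blast
    have "p x - p y \<noteq> 0" using stress_free_edge_nonzero[OF pq, of x y] by auto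
    then obtain c where c: "stress_free ?V (insert {x, y} ?E) L b (p(z := c)) q"
        "cross2 (c - p x) (p x - p y) \<noteq> 0"
      using stress_free_perturb[OF D'.finite_V D'.finite_L D'.edges pq] by blast
    have "cross2 ((p(z := c)) z - (p(z := c)) x) ((p(z := c)) x - (p(z := c)) y) \<noteq> 0"
      using c(2) xyz by simp
    from stress_free_edge_split[OF finite_V finite_L v edges _ xyz(2-4) xyE L(2) c(1) this]
    show ?thesis using xyz(1) unfolding neighbours_def by blast
  next
    case loop
    obtain l where l: "{l \<in> L. b l = v} = {l}" using loop(2) by (auto simp: card_1_singleton_iff)
    obtain u' w' where uw': "neighbours v = {u', w'}" "u' \<noteq> w'" using loop(1) by (auto simp: card_2_iff)
    obtain t where "t \<in> {u', w'}" and t: "\<forall>X. v \<notin> X \<longrightarrow> t \<in> X \<longrightarrow> \<not> pinned X"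
      using exists_loop_reduction[OF v uw' loop(2)] by blast
    \<comment> \<open>The neighbours are renamed so that \<open>u\<close> is the one that can
      receive the loop.\<close>
    then obtain u w where uw: "neighbours v = {u, w}" "u \<noteq> w"
      and free: "\<forall>X. v \<notin> X \<longrightarrow> u \<in> X \<longrightarrow> \<not> pinned X"
      using uw' by (metis insert_commute insertE singletonD)
    have V': "u \<in> ?V" "w \<in> ?V" using neighbours_sub[of v] uw(1) by auto
    have L: "insert l ?L = L" "l \<in> L" "l \<notin> ?L" "\<And>k. k \<in> L \<Longrightarrow> b k = v \<longleftrightarrow> k = l" using l by blast+
    have "sparse_graph ?V ?E (insert l ?L) (b(l := u))"
    proof (rule D.sparse_graph_insert_loop[OF V'(1) L(3)])
      fix X assume "u \<in> X"
      then show "\<not> D.pinned X" using tight(1)[of X] free[THEN spec, of X] by argo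
    qed
    then interpret D': sparse_graph ?V ?E L "b(l := u)" unfolding L(1) .
    obtain p q where pq: "stress_free ?V ?E L (b(l := u)) p q"
      using Suc.hyps(1)[OF n D'.sparse_graph_axioms] by blast
    obtain c where c: "stress_free ?V ?E L (b(l := u)) (p(w := c)) q" "cross2 (c - p u) (q l) \<noteq> 0"
      using stress_free_perturb[OF D'.finite_V D'.finite_L D'.edges pq stress_free_loop_nonzero[OF pq L(2)]]
      by blast
    have "cross2 ((p(w := c)) w - (p(w := c)) u) (q l) \<noteq> 0" using c(2) uw(2) by simp
    from stress_free_loop_split[OF finite_V finite_L v edges _ uw(2) L(2,4) c(1) this]
    show ?thesis using uw(1) unfolding neighbours_def by blast
  qed
qed

section \<open>The rank formula\<close>

lemma antisymmetric_double_sum: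
  fixes f :: "'a \<Rightarrow> 'a \<Rightarrow> 'b::real_vector"
  assumes "\<And>u v. f u v = - f v u"
  shows "(\<Sum>v\<in>A. \<Sum>u\<in>A. f u v) = 0"
proof -
  have "(\<Sum>v\<in>A. \<Sum>u\<in>A. f u v) = (\<Sum>u\<in>A. \<Sum>v\<in>A. f u v)" by (rule sum.swap)
  also have "\<dots> = (\<Sum>u\<in>A. \<Sum>v\<in>A. - f v u)" by (subst assms) (rule refl)
  also have "\<dots> = - (\<Sum>v\<in>A. \<Sum>u\<in>A. f u v)" by (simp add: sum_negf)
  finally show ?thesis by (simp only: eq_neg_iff_add_eq_0 scaleR_2[symmetric] scaleR_eq_0_iff) simp
qed

lemma cross2_sum_right: "cross2 x (\<Sum>u\<in>A. f u) = (\<Sum>u\<in>A. cross2 x (f u))"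
  by (simp add: cross2_def sum_component sum_distrib_left sum_subtractf)

text \<open>The forces along an edge on its two ends are opposite and act along the line joining
  them, so forces and torques cancel in pairs. These three relations are dual to the translations
  and the rotation.\<close>

lemma stress_force_balance:
  shows "(\<Sum>v\<in>Y. stress_force Y {} b p q \<omega> \<mu> v) = 0"
    and "(\<Sum>v\<in>Y. cross2 (p v) (stress_force Y {} b p q \<omega> \<mu> v)) = 0"
proof -
  show "(\<Sum>v\<in>Y. stress_force Y {} b p q \<omega> \<mu> v) = 0"
    unfolding stress_force_def sum.empty add_0_right
    by (rule antisymmetric_double_sum) (simp add: insert_commute flip: scaleR_minus_right)
  show "(\<Sum>v\<in>Y. cross2 (p v) (stress_force Y {} b p q \<omega> \<mu> v)) = 0"
    unfolding stress_force_def sum.empty add_0_right cross2_sum_right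
    by (rule antisymmetric_double_sum)
       (simp add: cross2_def insert_commute algebra_simps)
qed

text \<open>Three of the \<open>2 * card Y\<close> columns are redundant: both columns of
  \<open>u\<close> and one column of \<open>w\<close>, for an edge with ends \<open>u\<close> and
  \<open>w\<close>. Force and torque balance recover their equations from the others.\<close>

lemma rows_independent_induced_edges_card_le:
  assumes fin: "finite V" and E: "edges_on V E" and "Y \<subseteq> V" "card Y \<ge> 2"
    and ind: "rows_independent (rigidity_matrix G p q) (Inl ` E) (V \<times> UNIV)"
  shows "card {e \<in> E. e \<subseteq> Y} + 3 \<le> 2 * card Y"
proof (cases "{e \<in> E. e \<subseteq> Y} = {}")
  case True
  then show ?thesis using assms(4) by (simp only: card.empty)
next
  case False
  let ?E = "{e \<in> E. e \<subseteq> Y}" and ?M = "rigidity_matrix G p q"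
  have finY: "finite Y" using fin assms(3) finite_subset by blast
  have fE: "finite E" using edges_on_finite[OF fin E] .
  have EY: "edges_on Y ?E" using E by (auto simp: edges_on_def)
  have ind1: "rows_independent ?M (?E <+> ({} :: 'b set)) (V \<times> UNIV)"
    using rows_independent_subset[OF ind, of "?E <+> {}"] fE by (auto simp: Plus_def)
  obtain e where e: "e \<in> E" "e \<subseteq> Y" using False by auto
  then have eR: "Inl e \<in> ?E <+> ({} :: 'b set)" by auto
  have finR: "finite (?E <+> ({} :: 'b set))" using fE by simp
  \<comment> \<open>A nonzero entry in the row of an edge supplies its end \<open>w\<close> and a
    coordinate \<open>k\<close> in which the two ends differ.\<close>
  obtain c where c: "?M (Inl e) c \<noteq> 0"
    by (rule rows_independent_nonzero_entry[OF ind1 finR eR])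
  obtain w k where wk: "c = (w, k)" by (cases c)
  have we: "w \<in> e" using c wk by (auto split: if_splits)
  obtain u where u: "u \<noteq> w" "e = {u, w}" using edges_on_cases[OF E e(1) we] by blast
  have uw: "u \<in> Y" "w \<in> Y" using e u by auto
  have "the_elem (e - {w}) = u" using u the_elem_pair_diff by metis
  then have diff: "p w $ k \<noteq> p u $ k" using c wk we by simp
  have "\<exists>j. (\<forall>i. i = k \<or> i = j) \<and> j \<noteq> k"
    using exhaust_2[of k] by (auto simp: forall_2 intro: exI[of _ 1] exI[of _ 2])
  then obtain j where j: "\<And>i. i = k \<or> i = j" "j \<noteq> k" by blast
  define D where "D = Y \<times> UNIV - {(u, j), (u, k), (w, j)}"
  have "rows_independent ?M (?E <+> ({} :: 'b set)) D"
  proof (rule rows_independent_fewer_columns[OF ind1])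
    fix a and i :: "'a \<times> 2"
    let ?S = "\<lambda>i. \<Sum>r\<in>?E <+> ({} :: 'b set). a r * ?M r i"
    define F where
      "F = stress_force Y {} (base G) p q (\<lambda>e. if e \<in> ?E then a (Inl e) else 0) (\<lambda>l. a (Inr l))"
    assume z: "\<forall>i\<in>D. ?S i = 0"
    have S: "?S (x, i) = F x $ i" if "x \<in> Y" for x i
      unfolding F_def using rigidity_row_sum[OF finY finite.emptyI EY that] .
    have zF: "F x $ i = 0" if "x \<in> Y" "(x, i) \<notin> {(u, j), (u, k), (w, j)}" for x i
    proof -
      have "(x, i) \<in> D" using that by (simp add: D_def)
      with z have "?S (x, i) = 0" by (rule bspec)
      then show ?thesis unfolding S[OF that(1)] .
    qed
    have other: "F x = 0" if "x \<in> Y - {u} - {w}" for x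
      using zF that by (auto simp: vec_eq_iff)
    have "(\<Sum>x\<in>Y. g x) = g u + g w" if "\<And>x. x \<in> Y - {u} - {w} \<Longrightarrow> g x = 0" for g :: "'a \<Rightarrow> 'c::comm_monoid_add"
    proof -
      have "(\<Sum>x\<in>Y. g x) = g u + (g w + (\<Sum>x\<in>Y - {u} - {w}. g x))"
        using finY uw u by (subst sum.remove[of _ u]; (subst sum.remove[of _ w])?) auto
      also have "(\<Sum>x\<in>Y - {u} - {w}. g x) = 0" using that by (rule sum.neutral[OF ballI])
      finally show ?thesis by simp
    qed
    note two = this
    \<comment> \<open>Only \<open>u\<close> and \<open>w\<close> can carry a force. Force balance
      makes the two opposite, and torque balance makes \<open>F w\<close> parallel to
      \<open>p w - p u\<close>; as its coordinate \<open>k\<close> vanishes while the ends differ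
      there, \<open>F w\<close> is zero.\<close>
    have "F u + F w = 0"
      using stress_force_balance(1) two[of F, OF other] unfolding F_def by metis
    then have Fu: "F u = - F w" by (simp add: eq_neg_iff_add_eq_0)
    have "cross2 (p u) (F u) + cross2 (p w) (F w) = 0"
    proof -
      have "(\<Sum>x\<in>Y. cross2 (p x) (F x)) = 0" unfolding F_def by (rule stress_force_balance(2))
      then show ?thesis using two[of "\<lambda>x. cross2 (p x) (F x)"] other by (simp add: cross2_zero_right)
    qed
    then have "cross2 (p w - p u) (F w) = 0"
      unfolding Fu by (simp add: cross2_def algebra_simps)
    moreover have wk0: "F w $ k = 0" using zF[of w k] uw u j by auto
    moreover have "cross2 x y = 0 \<longleftrightarrow> x $ k * y $ j = x $ j * y $ k" for x y
      using j exhaust_2[of k] exhaust_2[of j] by (auto simp: cross2_def)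
    ultimately have wj0: "F w $ j = 0" using diff by simp
    have "F w $ i = 0" for i using j(1)[of i] wk0 wj0 by (elim disjE) simp_all
    then have Fw: "F w = 0" by (simp add: vec_eq_iff)
    have F0: "F x = 0" if "x \<in> Y" for x
      using other[of x] Fw Fu that by (cases "x = u \<or> x = w") auto
    assume i: "i \<in> V \<times> UNIV"
    show "?S i = 0"
    proof (cases "fst i \<in> Y")
      case True
      then show ?thesis using S[of "fst i" "snd i"] F0 by simp
    next
      case False
      then show ?thesis by (intro sum.neutral) (cases i; auto split: if_splits)
    qed
  qed
  moreover have finD: "finite D" using finY by (simp add: D_def)
  ultimately have "card (?E <+> ({} :: 'b set)) \<le> card D"
    using fE by (intro rows_independent_card_le) auto
  moreover have "card D = 2 * card Y - 3"
    unfolding D_def using finY uw u(1) j(2)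
    by (subst card_Diff_subset) (auto simp: card_cartesian_product)
  moreover have "card (?E <+> ({} :: 'b set)) = card ?E" using fE by (simp add: card_Plus)
  ultimately show ?thesis using assms(4) by simp
qed

text \<open>The rows vanish outside the \<open>2 * card Y\<close> columns of
  \<open>Y\<close>.\<close>

lemma rows_independent_induced_card_le:
  assumes fin: "finite V" "finite F" and "Y \<subseteq> V"
    and ind: "rows_independent (rigidity_matrix G p q) F (V \<times> UNIV)"
    and inside: "\<And>e. Inl e \<in> F \<Longrightarrow> e \<subseteq> Y" "\<And>l. Inr l \<in> F \<Longrightarrow> base G l \<in> Y"
  shows "card F \<le> 2 * card Y"
proof -
  have "rows_independent (rigidity_matrix G p q) F (Y \<times> UNIV)"
  proof (rule rows_independent_fewer_columns[OF ind])
    fix a and j :: "'a \<times> 2"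
    assume z: "\<forall>i\<in>Y \<times> UNIV. (\<Sum>r\<in>F. a r * rigidity_matrix G p q r i) = 0"
    have "rigidity_matrix G p q r j = 0" if "fst j \<notin> Y" "r \<in> F" for r
      using that inside by (cases r; cases j) auto
    moreover have "j \<in> Y \<times> UNIV" if "fst j \<in> Y" using that by (simp add: mem_Times_iff)
    ultimately show "(\<Sum>r\<in>F. a r * rigidity_matrix G p q r j) = 0"
      using z by (cases "fst j \<in> Y") auto
  qed
  then have "card F \<le> card (Y \<times> (UNIV :: 2 set))"
    using fin finite_subset[OF assms(3)] by (intro rows_independent_card_le) auto
  then show ?thesis by (simp add: card_cartesian_product)
qed

text \<open>The members of \<open>I\<close> are distributed over \<open>L'\<close>, the rows induced
  by \<open>X 0\<close> and the edges induced by the other \<open>X i\<close>; each share is at most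
  the matching summand of the value. Admissibility puts every loop outside \<open>L'\<close> at
  \<open>X 0\<close>.\<close>

lemma lc_independent_card_le_cover_val:
  fixes G :: "('v, 'l) looped_graph"
  assumes G: "looped_simple_graph G" and I: "lc_independent G I"
    and L': "L' \<subseteq> loops G" and cov: "is_cover (delete_loops G L') k X" and adm: "admissible G L' X"
  shows "int (card I) \<le> cover_val L' k X"
proof -
  have fin: "finite (verts G)" "finite (loops G)" and E: "edges_on (verts G) (edges G)"
    using G by (auto simp: looped_simple_graph_def edges_on_def)
  have Isub: "I \<subseteq> ground G" using I by (simp add: lc_independent_def)
  have finI: "finite I"
    by (rule finite_subset[OF Isub]) (simp add: ground_def fin edges_on_finite[OF fin(1) E])
  obtain p q where ind: "rows_independent (rigidity_matrix G p q) I (verts G \<times> UNIV)"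
    using I by (auto simp: lc_independent_def)
  have sub: "X i \<subseteq> verts G" if "i \<le> k" for i
    using cov that by (auto simp: is_cover_def delete_loops_def)
  have two: "card (X i) \<ge> 2" if "i \<in> {1..k}" for i
    using cov that by (auto simp: is_cover_def)
  have cover: "\<exists>i\<le>k. e \<subseteq> X i" if "e \<in> edges G" for e
    using cov that by (auto simp: is_cover_def delete_loops_def)
  define I0 where "I0 = {r \<in> I. case r of Inl e \<Rightarrow> e \<subseteq> X 0 | Inr l \<Rightarrow> base G l \<in> X 0}"
  define E1 where "E1 = {e. Inl e \<in> I}"
  define J :: "nat \<Rightarrow> ('v set + 'l) set" where "J i = Inl ` {e \<in> E1. e \<subseteq> X i}" for i
  define K :: "('v set + 'l) set" where "K = Inr ` L'"
  have E1: "E1 \<subseteq> edges G" using Isub by (auto simp: E1_def ground_def)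
  then have EE1: "edges_on (verts G) E1" using E by (auto simp: edges_on_def)
  have fE1: "finite E1" using edges_on_finite[OF fin(1) EE1] .
  have "I \<subseteq> K \<union> I0 \<union> (\<Union>i\<in>{1..k}. J i)"
  proof
    fix r assume r: "r \<in> I"
    show "r \<in> K \<union> I0 \<union> (\<Union>i\<in>{1..k}. J i)"
    proof (cases r)
      case (Inl e)
      then have "e \<in> E1" using r by (simp add: E1_def)
      then obtain i where "i \<le> k" "e \<subseteq> X i" using cover E1 by blast
      then show ?thesis using r \<open>e \<in> E1\<close> unfolding Inl I0_def J_def by (cases "i = 0") force+
    next
      case (Inr l)
      then have "l \<in> loops G" using r Isub by (auto simp: ground_def)
      then show ?thesis using r Inr adm by (cases "l \<in> L'") (auto simp: I0_def K_def admissible_def)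
    qed
  qed
  then have "card I \<le> card (K \<union> I0 \<union> (\<Union>i\<in>{1..k}. J i))"
    using fin L' finI fE1 finite_subset[OF L'] by (intro card_mono) (auto simp: I0_def J_def K_def)
  also have "\<dots> \<le> card (K \<union> I0) + card (\<Union>i\<in>{1..k}. J i)"
    by (rule card_Un_le)
  also have "\<dots> \<le> card K + card I0 + (\<Sum>i=1..k. card (J i))"
    by (intro add_mono card_Un_le card_UN_le) simp
  finally have le: "card I \<le> card L' + card I0 + (\<Sum>i=1..k. card {e \<in> E1. e \<subseteq> X i})"
    by (simp add: card_image J_def K_def)
  have "card I0 \<le> 2 * card (X 0)"
  proof (rule rows_independent_induced_card_le[OF fin(1)])
    show "rows_independent (rigidity_matrix G p q) I0 (verts G \<times> UNIV)"
      using rows_independent_subset[OF ind finI] by (auto simp: I0_def)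
  qed (use finI sub in \<open>auto simp: I0_def\<close>)
  moreover have "(\<Sum>i=1..k. int (card {e \<in> E1. e \<subseteq> X i})) \<le> (\<Sum>i=1..k. 2 * int (card (X i)) - 3)"
  proof (rule sum_mono)
    fix i assume i: "i \<in> {1..k}"
    have "rows_independent (rigidity_matrix G p q) (Inl ` E1) (verts G \<times> UNIV)"
      by (rule rows_independent_subset[OF ind finI]) (auto simp: E1_def)
    then have "card {e \<in> E1. e \<subseteq> X i} + 3 \<le> 2 * card (X i)"
      using rows_independent_induced_edges_card_le[OF fin(1) EE1 sub two[OF i]] i by simp
    then show "int (card {e \<in> E1. e \<subseteq> X i}) \<le> 2 * int (card (X i)) - 3" by linarith
  qed
  moreover have "int (\<Sum>i=1..k. card {e \<in> E1. e \<subseteq> X i}) = (\<Sum>i=1..k. int (card {e \<in> E1. e \<subseteq> X i}))"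
    by (rule of_nat_sum)
  ultimately show ?thesis using le unfolding cover_val_def by linarith
qed

section \<open>The tight cover and the rank\<close>

context sparse_graph begin

text \<open>Pinned sets are closed under union, so one of largest cardinality contains all
  others.\<close>

lemma exists_greatest_pinned: "\<exists>P. pinned P \<and> (\<forall>X. pinned X \<longrightarrow> X \<subseteq> P)"
proof -
  have "\<forall>X. pinned X \<longrightarrow> card X < Suc (card V)"
    using card_mono[OF finite_V] by (auto simp: pinned_def less_Suc_eq_le)
  then obtain P where P: "pinned P" "\<forall>X. pinned X \<longrightarrow> card X \<le> card P"
    using ex_has_greatest_nat[of pinned "{}" card, OF pinned_empty] by blast
  have "X \<subseteq> P" if "pinned X" for X
  proof -
    have u: "pinned (P \<union> X)" using pinned_Un[OF P(1) that] .
    then have "finite (P \<union> X)" using finite_sub by (simp add: pinned_def)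
    then have "P \<union> X = P" using P(2) u card_seteq[of "P \<union> X" P] by blast
    then show ?thesis by blast
  qed
  then show ?thesis using P(1) by blast
qed

text \<open>Two vertices and one edge attain \<open>2 * 2 - 3 = 1\<close>; this is what makes the
  maximal rigid sets cover the edges.\<close>

lemma edge_rigid: "e \<in> E \<Longrightarrow> rigid e"
proof -
  assume e: "e \<in> E"
  then have "card {e} \<le> edge_count E e"
    unfolding edge_count_def using finite_E by (intro card_mono) auto
  moreover have "e \<subseteq> V" "card e = 2" using e edges by (auto simp: edges_on_def)
  ultimately show "rigid e" using edge_count_le[of e] by (simp add: rigid_def)
qed

text \<open>Every edge of \<open>E\<close> is induced by exactly one member of the family, so the
  equalities defining tightness add up to the size of the sparse set, with the loops off
  \<open>X 0\<close> counted one by one.\<close>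

lemma exists_tight_cover:
  "\<exists>k X. pinned (X 0) \<and> (\<forall>Y. pinned Y \<longrightarrow> Y \<subseteq> X 0) \<and> (\<forall>i\<in>{1..k}. rigid (X i)) \<and> one_thin k X \<and>
     (\<forall>R. rigid R \<longrightarrow> (\<exists>i\<le>k. R \<subseteq> X i)) \<and>
     int (card E + card L) = cover_val {l \<in> L. b l \<notin> X 0} k X"
proof -
  obtain P where P: "pinned P" "\<And>Y. pinned Y \<Longrightarrow> Y \<subseteq> P" using exists_greatest_pinned by blast
  have PV: "P \<subseteq> V" using P(1) by (simp add: pinned_def)
  \<comment> \<open>Maximal rigid sets inside \<open>P\<close> are left out: their edges are already
    counted for \<open>P\<close>.\<close>
  define \<R> where "\<R> = {R. rigid R \<and> \<not> R \<subseteq> P \<and> (\<forall>S. rigid S \<longrightarrow> R \<subseteq> S \<longrightarrow> S = R)}"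
  have \<R>V: "R \<subseteq> V" if "R \<in> \<R>" for R using that by (simp add: \<R>_def rigid_def)
  have fin\<R>: "finite \<R>" by (rule finite_subset[of _ "Pow V"]) (use \<R>V finite_V in auto)
  have covered: "R \<subseteq> P \<or> (\<exists>S\<in>\<R>. R \<subseteq> S)" if R: "rigid R" for R
  proof -
    have "\<forall>S. rigid S \<and> R \<subseteq> S \<longrightarrow> card S < Suc (card V)"
      using card_mono[OF finite_V] by (auto simp: rigid_def less_Suc_eq_le)
    then obtain S where S: "rigid S" "R \<subseteq> S" and Smax: "\<forall>T. rigid T \<and> R \<subseteq> T \<longrightarrow> card T \<le> card S"
      using ex_has_greatest_nat[of "\<lambda>S. rigid S \<and> R \<subseteq> S" R card "Suc (card V)"] R by blast
    have "T = S" if "rigid T" "S \<subseteq> T" for T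
    proof -
      have "finite T" using that finite_sub by (simp add: rigid_def)
      moreover have "card T \<le> card S" using Smax that S by auto
      ultimately show ?thesis using card_seteq[of T S] that by auto
    qed
    then show ?thesis using S by (cases "R \<subseteq> P") (auto simp: \<R>_def)
  qed
  have thin: "card (R \<inter> S) \<le> 1" if "R \<in> \<R>" "S \<in> \<R>" "R \<noteq> S" for R S
  proof (rule ccontr)
    assume "\<not> ?thesis"
    then have "rigid (R \<union> S)" using that rigid_Un by (auto simp: \<R>_def)
    then show False using that unfolding \<R>_def by blast
  qed
  \<comment> \<open>Two common vertices would make the union pinned, hence \<open>R\<close>
    contained in the greatest pinned set.\<close>
  have thinP: "card (P \<inter> R) \<le> 1" if "R \<in> \<R>" for R
  proof (rule ccontr)
    assume "\<not> ?thesis"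
    then have "pinned (P \<union> R)" using that P(1) pinned_rigid_Un by (auto simp: \<R>_def)
    then show False using that P(2) by (auto simp: \<R>_def)
  qed
  let ?k = "card \<R>"
  obtain h where h: "bij_betw h {1..?k} \<R>" using ex_bij_betw_nat_finite_1[OF fin\<R>] by blast
  \<comment> \<open>Index 0 is reserved for the pinned set; the numbering of the rigid sets starts
    at 1.\<close>
  define X where "X i = (if i = 0 then P else h i)" for i
  have hR: "h i \<in> \<R>" if "i \<in> {1..?k}" for i using bij_betw_apply[OF h that] .
  have h_onto: "\<exists>i\<in>{1..?k}. h i = R" if "R \<in> \<R>" for R
  proof -
    have "R \<in> h ` {1..?k}" using that by (simp only: bij_betw_imp_surj_on[OF h])
    then show ?thesis by (auto simp del: atLeastAtMost_iff)
  qed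
  have "one_thin ?k X"
    unfolding one_thin_def
  proof (intro allI impI)
    fix i j assume ij: "i < j \<and> j \<le> ?k"
    show "card (X i \<inter> X j) \<le> 1"
    proof (cases "i = 0")
      case True
      then show ?thesis using ij thinP hR[of j] by (simp add: X_def)
    next
      case False
      then have "h i \<noteq> h j"
        using inj_on_eq_iff[OF bij_betw_imp_inj_on[OF h], of i j] ij by simp
      then show ?thesis using False ij thin hR[of i] hR[of j] by (simp add: X_def)
    qed
  qed
  moreover have "\<exists>i\<le>?k. R \<subseteq> X i" if "rigid R" for R
    using covered[OF that]
  proof
    assume "R \<subseteq> P"
    then show ?thesis by (intro exI[of _ 0]) (simp add: X_def)
  next
    assume "\<exists>S\<in>\<R>. R \<subseteq> S"
    then obtain i where "i \<in> {1..?k}" "R \<subseteq> h i" using h_onto by blast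
    then show ?thesis by (intro exI[of _ i]) (simp add: X_def)
  qed
  moreover have "int (card E + card L) = cover_val {l \<in> L. b l \<notin> X 0} ?k X"
  proof -
    let ?F = "\<lambda>R. {e \<in> E. e \<subseteq> R}"
    have "E = ?F P \<union> (\<Union>R\<in>\<R>. ?F R)" using covered edge_rigid by auto
    moreover have "?F P \<inter> (\<Union>R\<in>\<R>. ?F R) = {}" using disjoint_edges[OF thinP PV] by blast
    ultimately have "card E = card (?F P) + card (\<Union>R\<in>\<R>. ?F R)"
      using card_Un_disjoint[of "?F P" "\<Union>R\<in>\<R>. ?F R"] finite_E fin\<R> by simp
    also have "card (\<Union>R\<in>\<R>. ?F R) = (\<Sum>R\<in>\<R>. card (?F R))"
    proof (rule card_UN_disjoint[OF fin\<R>])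
      show "\<forall>R\<in>\<R>. \<forall>S\<in>\<R>. R \<noteq> S \<longrightarrow> ?F R \<inter> ?F S = {}"
        using disjoint_edges[OF thin \<R>V] by blast
    qed (use finite_E in auto)
    finally have "int (card E) = int (edge_count E P) + (\<Sum>R\<in>\<R>. int (edge_count E R))"
      by (simp add: edge_count_def)
    also have "(\<Sum>R\<in>\<R>. int (edge_count E R)) = (\<Sum>R\<in>\<R>. 2 * int (card R) - 3)"
      by (intro sum.cong refl) (auto simp: \<R>_def rigid_def)
    also have "\<dots> = (\<Sum>i=1..?k. 2 * int (card (h i)) - 3)"
      by (rule sum.reindex_bij_betw[OF h, symmetric])
    also have "\<dots> = (\<Sum>i=1..?k. 2 * int (card (X i)) - 3)"
      by (intro sum.cong refl) (simp add: X_def)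
    finally have cE: "int (card E) = int (edge_count E P) + (\<Sum>i=1..?k. 2 * int (card (X i)) - 3)" .
    have "L = {l \<in> L. b l \<in> P} \<union> {l \<in> L. b l \<notin> P}" by auto
    then have cL: "card L = loop_count L b P + card {l \<in> L. b l \<notin> P}"
      using card_Un_disjoint[of "{l \<in> L. b l \<in> P}" "{l \<in> L. b l \<notin> P}"] finite_L
      by (auto simp: loop_count_def)
    show ?thesis using cE cL P(1) unfolding cover_val_def X_def pinned_def by simp
  qed
  moreover have "rigid (X i)" if "i \<in> {1..?k}" for i
    using hR[OF that] that by (simp add: X_def \<R>_def)
  ultimately show ?thesis using P by (intro exI[of _ ?k] exI[of _ X]) (auto simp: X_def)
qed

end

text \<open>A sparse set of greatest size provides both objects: it is independent by the
  realisation theorem, and its tight cover covers all of \<open>G\<close> because any edge or loop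
  left out could be added.\<close>

lemma exists_lc_independent_cover:
  assumes G: "looped_simple_graph G"
  shows "\<exists>I L' k X. lc_independent G I \<and> L' \<subseteq> loops G \<and> is_cover (delete_loops G L') k X \<and>
    admissible G L' X \<and> one_thin k X \<and> int (card I) = cover_val L' k X"
proof -
  have fin: "finite (verts G)" "finite (loops G)" and EG: "edges_on (verts G) (edges G)"
    and LG: "\<And>l. l \<in> loops G \<Longrightarrow> base G l \<in> verts G"
    using G by (auto simp: looped_simple_graph_def edges_on_def)
  have fE: "finite (edges G)" using edges_on_finite[OF fin(1) EG] .
  let ?sp = "\<lambda>(E, L). E \<subseteq> edges G \<and> L \<subseteq> loops G \<and> sparse_graph (verts G) E L (base G)"
  let ?size = "\<lambda>(E, L). card E + card L"
  have sp0: "?sp ({}, {})"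
    using fin by (auto simp: sparse_graph_def edges_on_def edge_count_def loop_count_def)
  have bound: "\<forall>x. ?sp x \<longrightarrow> ?size x < Suc (card (edges G) + card (loops G))"
    using card_mono[OF fE] card_mono[OF fin(2)] by (auto simp: less_Suc_eq_le intro!: add_mono)
  obtain x where x: "?sp x" "\<forall>y. ?sp y \<longrightarrow> ?size y \<le> ?size x"
    by (rule exE[OF ex_has_greatest_nat[where P = ?sp and f = ?size, OF sp0 bound]]) (elim conjE)
  obtain E L where EL: "x = (E, L)" by (cases x)
  have sub: "E \<subseteq> edges G" "L \<subseteq> loops G" and sp: "sparse_graph (verts G) E L (base G)"
    using x(1) EL by auto
  have max: "card E' + card L' \<le> card E + card L"
    if "E' \<subseteq> edges G" "L' \<subseteq> loops G" "sparse_graph (verts G) E' L' (base G)" for E' L'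
    using x(2)[THEN spec, of "(E', L')"] that EL by simp
  interpret sparse_graph "verts G" E L "base G" by (rule sp)
  obtain k X where X: "pinned (X 0)" "\<forall>Y. pinned Y \<longrightarrow> Y \<subseteq> X 0" "\<forall>i\<in>{1..k}. rigid (X i)" "one_thin k X"
    "\<forall>R. rigid R \<longrightarrow> (\<exists>i\<le>k. R \<subseteq> X i)" "int (card E + card L) = cover_val {l \<in> L. base G l \<notin> X 0} k X"
    using exists_tight_cover by blast
  \<comment> \<open>All loops of \<open>G\<close> off \<open>X 0\<close> are taken. They belong to
    \<open>L\<close>, since such a loop is at a vertex in no pinned set and could otherwise be
    added.\<close>
  define L' where "L' = {l \<in> loops G. base G l \<notin> X 0}"
  have "l \<in> L" if l: "l \<in> L'" for l
  proof (rule ccontr)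
    assume nl: "l \<notin> L"
    have "sparse_graph (verts G) E (insert l L) ((base G)(l := base G l))"
      using l X(2) LG nl by (intro sparse_graph_insert_loop) (auto simp: L'_def)
    then have "card E + card (insert l L) \<le> card E + card L"
      using l sub by (intro max) (auto simp: L'_def)
    then show False using nl finite_L by simp
  qed
  then have L': "{l \<in> L. base G l \<notin> X 0} = L'" using sub by (auto simp: L'_def)
  have cov: "\<exists>i\<le>k. e \<subseteq> X i" if e: "e \<in> edges G" for e
  proof (cases "e \<in> E")
    case True
    then show ?thesis using X(5) edge_rigid by blast
  next
    case False
    have "card e = 2" "e \<subseteq> verts G" using e EG by (auto simp: edges_on_def)
    then obtain x y where xy: "e = {x, y}" "x \<noteq> y" "x \<in> verts G" "y \<in> verts G"
      by (auto simp: card_2_iff)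
    \<comment> \<open>An edge whose ends lie in no common tight set could be added, contrary to the
      choice of \<open>E\<close> and \<open>L\<close>.\<close>
    have "\<exists>Y. x \<in> Y \<and> y \<in> Y \<and> (rigid Y \<or> pinned Y)"
    proof (rule ccontr)
      assume "\<not> ?thesis"
      then have "sparse_graph (verts G) (insert {x, y} E) L (base G)"
        using xy by (intro sparse_graph_insert_edge) auto
      then have "card (insert {x, y} E) + card L \<le> card E + card L"
        using e sub xy by (intro max) auto
      then show False using False xy finite_E by simp
    qed
    then obtain Y where Y: "e \<subseteq> Y" "rigid Y \<or> pinned Y" using xy by auto
    then show ?thesis using X(2,5) by (meson order_trans le0)
  qed
  have "X i \<subseteq> verts G" "i \<in> {1..k} \<longrightarrow> card (X i) \<ge> 2" if "i \<le> k" for i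
    using X(1,3) that by (cases "i = 0"; auto simp: pinned_def rigid_def)+
  then have "is_cover (delete_loops G L') k X"
    using cov by (auto simp: is_cover_def delete_loops_def L'_def)
  moreover have "admissible G L' X" using LG by (auto simp: admissible_def L'_def)
  moreover have "int (card (E <+> L)) = cover_val L' k X"
    using X(6) L' finite_E finite_L by (simp add: card_Plus)
  moreover have "lc_independent G (E <+> L)"
    using sparse_graph_stress_free[OF sp] stress_free_imp_lc_independent[OF G sub] by blast
  moreover have "L' \<subseteq> loops G" by (auto simp: L'_def)
  ultimately show ?thesis using X(4) by blast
qed

theorem theorem1p4:
  fixes G :: "('v, 'l) looped_graph"
  assumes "looped_simple_graph G"
  shows "int (lc_rank G (ground G)) =
    Min {cover_val L' k X | L' k X.
      L' \<subseteq> loops G \<and> is_cover (delete_loops G L') k X \<and> admissible G L' X \<and> one_thin k X}"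
proof -
  let ?S = "{card I | I. I \<subseteq> ground G \<and> lc_independent G I}"
  have "finite (ground G)"
    using assms edges_on_finite[of "verts G" "edges G"]
    by (auto simp: looped_simple_graph_def edges_on_def ground_def)
  then have finS: "finite ?S"
    by (intro finite_subset[of ?S "card ` Pow (ground G)"]) auto
  obtain I L' k X where I: "lc_independent G I" and cov: "L' \<subseteq> loops G"
      "is_cover (delete_loops G L') k X" "admissible G L' X" "one_thin k X"
    and eq: "int (card I) = cover_val L' k X"
    using exists_lc_independent_cover[OF assms] by blast
  have cI: "card I \<in> ?S" using I by (auto simp: lc_independent_def)
  then have "lc_rank G (ground G) \<in> ?S" unfolding lc_rank_def using finS Max_in by blast
  then obtain J where J: "lc_independent G J" "lc_rank G (ground G) = card J" by auto
  have "card I \<le> lc_rank G (ground G)" unfolding lc_rank_def using finS cI by (rule Max_ge)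
  \<comment> \<open>The set \<open>I\<close> bounds the rank from below, and the cover bounds the
    largest independent set \<open>J\<close> from above by the same number.\<close>
  then have rank: "int (lc_rank G (ground G)) = cover_val L' k X"
    using lc_independent_card_le_cover_val[OF assms J(1) cov(1-3)] eq J(2) by simp
  show ?thesis
  proof (rule Min_eqI[symmetric])
    show "finite {cover_val L' k X | L' k X.
        L' \<subseteq> loops G \<and> is_cover (delete_loops G L') k X \<and> admissible G L' X \<and> one_thin k X}"
      by (rule finite_admissible_cover_vals[OF assms])
    show "int (lc_rank G (ground G)) \<in> {cover_val L' k X | L' k X.
        L' \<subseteq> loops G \<and> is_cover (delete_loops G L') k X \<and> admissible G L' X \<and> one_thin k X}"
      using rank cov by blast
    fix y assume "y \<in> {cover_val L' k X | L' k X.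
        L' \<subseteq> loops G \<and> is_cover (delete_loops G L') k X \<and> admissible G L' X \<and> one_thin k X}"
    then show "int (lc_rank G (ground G)) \<le> y"
      using lc_independent_card_le_cover_val[OF assms J(1)] J(2) by auto
  qed
qed

end
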